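(* Let $u$ be an ultrafilter on $\omega$ and let $V$, $W$ be monotone sequential cascades of finite ranks with $\max V,\max W\subseteq\omega$, such that $\int V\subseteq u$ and $\int W\subseteq u$. Let $n,m$ be natural numbers such that $n_V E_u m_W$ holds, i.e. for every choice of sets $\tilde V_{p,s}\in\int V_p$ and $\tilde W_{p,s}\in\int W_s$, indexed by $(p,s)\in L_{n,V}\times L_{m,W}$, one has $\bigcup_{(p,s)\in L_{n,V}\times L_{m,W}}(\tilde V_{p,s}\cap\tilde W_{p,s})\in u$. Then there exists a monotone sequential cascade $T$ with $\max\{r(V),r(W)\}\le r(T)\le r(V)+r(W)$ such that $\int T\subseteq u$, $T\Rrightarrow V$, $T\Rrightarrow W$, $\int V\subseteq\int T$ and $\int W\subseteq\int T$.
   Context: A cascade is a tree $(V,\sqsubseteq)$ without infinite branches and with a least element $\emptyset_V$; $\max V$ is its set of maximal elements, and $v^+$ the set of immediate successors of $v$. It is sequential if $v^+$ is countably infinite for every $v\in V\setminus\max V$. Rank: $r(v)=0$ for $v\in\max V$, otherwise $r(v)$ is the least ordinal greater than $r(v')$ for all $v'\in v^+$; $r(V)=r(\emptyset_V)$. A sequential cascade is monotone if each $v^+$ ($v\notin\max V$) can be enumerated as $(v_n)_{n<\omega}$ with $(r(v_n))_n$ non-decreasing; such an enumeration is fixed. Labels: $v_\emptyset=\emptyset_V$, $v_{l^\frown n}$ is the $n$-th element of $v_l^+$; $V_l$ is the subcascade of $v_l$ and all elements above it; $L_{\alpha,V}=\{l:r_V(v_l)=\alpha\}$. All cascades have $\max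 V\subseteq\omega$. The contour $\int V$: give $V$ the finest topology in which for each non-maximal $v$ the cofinite filter on $v^+$ converges to $v$; $\int V$ is the trace on $\max V$ of the neighbourhood filter of $\emptyset_V$; filters on subsets of $\omega$ are identified with the filters on $\omega$ they generate. Lexicographic order on $V$: $v'<_{lex}v''$ if $v'\sqsupset v''$, or there are $v$ and $\tilde v'\sqsubseteq v'$, $\tilde v''\sqsubseteq v''$ with $\tilde v'=v_n$, $\tilde v''=v_m\in v^+$ and $n<m$. $f_V:\max V\to\omega_1$ denotes a function with $v'<_{lex}v''\iff f_V(v')<f_V(v'')$ for $v',v''\in\max V$. $\mathrm{ot}$ denotes order type, and $\mathrm{indec}(\alpha)$ is the largest indecomposable ordinal $\le\alpha$ (taken as $0$ for $\alpha=0$). For monotone sequential cascades $V,W$ with $\max V\supseteq\max W$, $W\Rrightarrow V$ ("$W$ increases the order of $V$") means $\mathrm{ot}(f_W(U))\ge\mathrm{indec}(\mathrm{ot}(f_V(U)))$ for every $U\subseteq\max W$. *)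

theory Defs
  imports "HOL-Analysis.Analysis"
begin

section \<open>Countable ordinals\<close>

typedef omega1 = "Field (cardSuc natLeq)"
proof -
  have "infinite (Field (cardSuc natLeq))"
    using cardSuc_finite[OF natLeq_Card_order] Field_natLeq by simp
  then have "Field (cardSuc natLeq) \<noteq> {}" by force
  then show ?thesis by blast
qed

instantiation omega1 :: wellorder
begin

definition less_eq_omega1 :: "omega1 \<Rightarrow> omega1 \<Rightarrow> bool" where
  "x \<le> y \<longleftrightarrow> (Rep_omega1 x, Rep_omega1 y) \<in> cardSuc natLeq"

definition less_omega1 :: "omega1 \<Rightarrow> omega1 \<Rightarrow> bool" where
  "(x :: omega1) < y \<longleftrightarrow> x \<le> y \<and> x \<noteq> y"

instance
proof -
  let ?r = "cardSuc natLeq"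
  have wo: "Well_order ?r"
    using cardSuc_Card_order[OF natLeq_Card_order] card_order_on_well_order_on by blast
  have refl: "(Rep_omega1 x, Rep_omega1 x) \<in> ?r" for x
    using wo Rep_omega1[of x]
    by (auto simp: order_on_defs refl_on_def)
  have tr: "trans ?r" and an: "antisym ?r" and tot: "Total ?r" and wf: "wf (?r - Id)"
    using wo by (auto simp: order_on_defs)
  have 1: "x \<le> y \<or> y \<le> x" for x y :: omega1
    using tot refl Rep_omega1[of x] Rep_omega1[of y]
    unfolding less_eq_omega1_def total_on_def by metis
  have 2: "x \<le> y \<Longrightarrow> y \<le> x \<Longrightarrow> x = y" for x y :: omega1
    using an unfolding less_eq_omega1_def by (meson Rep_omega1_inject antisymD)
  have 3: "x \<le> y \<Longrightarrow> y \<le> z \<Longrightarrow> x \<le> z" for x y z :: omega1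
    using tr unfolding less_eq_omega1_def by (meson transD)
  have 4: "{(x, y). x < y} \<subseteq> inv_image (?r - Id) Rep_omega1"
    by (auto simp: less_omega1_def less_eq_omega1_def Rep_omega1_inject)
  have 5: "wf {(x :: omega1, y). x < y}"
    by (rule wf_subset[OF wf_inv_image[OF wf] 4])
  show "OFCLASS(omega1, wellorder_class)"
  proof
    fix x y z :: omega1
    show "(x < y) = (x \<le> y \<and> \<not> y \<le> x)"
      using 1 2 by (auto simp: less_omega1_def)
    show "x \<le> x" using refl by (simp add: less_eq_omega1_def)
    show "x \<le> y \<Longrightarrow> y \<le> z \<Longrightarrow> x \<le> z" by (rule 3)
    show "x \<le> y \<Longrightarrow> y \<le> x \<Longrightarrow> x = y" by (rule 2)
    show "x \<le> y \<or> y \<le> x" by (rule 1)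
  next
    fix P :: "omega1 \<Rightarrow> bool" and a
    assume *: "\<And>x. (\<And>y. y < x \<Longrightarrow> P y) \<Longrightarrow> P x"
    show "P a"
      using 5 by (induction a rule: wf_induct_rule) (use * in auto)
  qed
qed

end

context
  includes cardinal_syntax
begin

lemma countable_iff_card_of_natLeq: "countable A \<longleftrightarrow> |A| \<le>o natLeq"
proof -
  have "countable A \<longleftrightarrow> |A| \<le>o |UNIV :: nat set|"
    unfolding countable_def card_of_ordLeq[symmetric] by simp
  then show ?thesis
    using card_of_nat ordIso_symmetric ordLeq_ordIso_trans by blast
qed

lemma countable_lessThan_omega1: "countable {..<(a :: omega1)}"
proof -
  let ?r = "cardSuc natLeq"
  have co: "Card_order ?r"
    by (rule cardSuc_Card_order[OF natLeq_Card_order])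
  have "|underS ?r (Rep_omega1 a)| <o ?r"
    by (rule card_of_underS[OF co Rep_omega1])
  then have "|underS ?r (Rep_omega1 a)| \<le>o natLeq"
    using cardSuc_ordLeq_ordLess[OF natLeq_Card_order card_of_Card_order] by blast
  then have "countable (underS ?r (Rep_omega1 a))"
    using countable_iff_card_of_natLeq by blast
  moreover have "Rep_omega1 ` {..<a} \<subseteq> underS ?r (Rep_omega1 a)"
    by (auto simp: underS_def less_omega1_def less_eq_omega1_def Rep_omega1_inject)
  ultimately have "countable (Rep_omega1 ` {..<a})"
    using countable_subset by blast
  then show ?thesis
    by (rule countable_image_inj_on) (simp add: inj_on_def Rep_omega1_inject)
qed

lemma uncountable_omega1: "uncountable (UNIV :: omega1 set)"
proof
  let ?r = "cardSuc natLeq"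
  assume "countable (UNIV :: omega1 set)"
  then have "countable (Rep_omega1 ` UNIV)" by (rule countable_image)
  then have "countable (Field ?r)"
    using type_definition.Rep_range[OF type_definition_omega1] by simp
  then have "|Field ?r| \<le>o natLeq"
    using countable_iff_card_of_natLeq by blast
  moreover have "|Field ?r| =o ?r"
    by (rule card_of_Field_ordIso[OF cardSuc_Card_order[OF natLeq_Card_order]])
  ultimately have "?r \<le>o natLeq"
    using ordIso_ordLeq_trans ordIso_symmetric by blast
  then show False
    using cardSuc_greater[OF natLeq_Card_order] not_ordLess_ordLeq by blast
qed

end

lemma countable_bounded_omega1:
  assumes "countable (A :: omega1 set)"
  shows "\<exists>c. \<forall>a\<in>A. a < c"
proof (rule ccontr)
  assume "\<not> ?thesis"
  then have "UNIV \<subseteq> (\<Union>a\<in>A. insert a {..<a})"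
    by (force simp: not_less le_less)
  moreover have "countable (\<Union>a\<in>A. insert a {..<a})"
    using assms countable_lessThan_omega1 by auto
  ultimately show False
    using uncountable_omega1 countable_subset by blast
qed

instantiation omega1 :: "{zero, plus}"
begin

definition zero_omega1 :: omega1 where
  "0 = (LEAST a :: omega1. True)"

function plus_omega1 :: "omega1 \<Rightarrow> omega1 \<Rightarrow> omega1" where
  "plus_omega1 a b = (LEAST c. a \<le> c \<and> (\<forall>b'\<in>{..<b}. plus_omega1 a b' < c))"
  by auto
termination
  by (relation "inv_image {(x, y). x < y} snd") (auto intro: wf)

instance ..

end

declare plus_omega1.simps [simp del]

fun ord_of_nat :: "nat \<Rightarrow> omega1" where
  "ord_of_nat 0 = 0"
| "ord_of_nat (Suc n) = (LEAST a. ord_of_nat n < a)"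

definition indecomposable :: "omega1 \<Rightarrow> bool" where
  "indecomposable a \<longleftrightarrow> a \<noteq> 0 \<and> (\<forall>b<a. \<forall>c<a. b + c < a)"

definition indec :: "omega1 \<Rightarrow> omega1" where
  "indec a = (if a = 0 then 0 else (GREATEST b. indecomposable b \<and> b \<le> a))"

text \<open>Only meaningful for countable sets: an uncountable subset of \<open>omega1\<close> is not
  isomorphic to a proper initial segment.\<close>

definition ot :: "omega1 set \<Rightarrow> omega1" where
  "ot A = (THE a. \<exists>g. bij_betw g A {..<a} \<and> strict_mono_on A g)"


section \<open>Cascades\<close>

text \<open>A tree together with a map \<^term>\<open>child\<close>; for a monotone sequential cascade,
  \<open>child V v\<close> is the fixed enumeration of the immediate successors of a non-maximal node \<open>v\<close>.
  The order is only relevant on \<^term>\<open>nodes\<close>.\<close>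

record 'a cascade =
  nodes :: "'a set"
  le_node :: "'a \<Rightarrow> 'a \<Rightarrow> bool"
  child :: "'a \<Rightarrow> nat \<Rightarrow> 'a"

definition less_node :: "'a cascade \<Rightarrow> 'a \<Rightarrow> 'a \<Rightarrow> bool" where
  "less_node V v w \<longleftrightarrow> le_node V v w \<and> v \<noteq> w"

definition is_tree :: "'a cascade \<Rightarrow> bool" where
  "is_tree V \<longleftrightarrow>
     reflp_on (nodes V) (le_node V) \<and> antisymp_on (nodes V) (le_node V) \<and>
     transp_on (nodes V) (le_node V) \<and>
     (\<forall>v\<in>nodes V. totalp_on {w \<in> nodes V. less_node V w v} (less_node V) \<and>
                   wfp_on {w \<in> nodes V. less_node V w v} (less_node V))"

text \<open>Branches are maximal chains.\<close>

definition is_cascade :: "'a cascade \<Rightarrow> bool" where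
  "is_cascade V \<longleftrightarrow>
     is_tree V \<and>
     (\<forall>B. pred_on.maxchain (nodes V) (less_node V) B \<longrightarrow> finite B) \<and>
     (\<exists>r\<in>nodes V. \<forall>v\<in>nodes V. le_node V r v)"

definition root_node :: "'a cascade \<Rightarrow> 'a" where
  "root_node V = (THE r. r \<in> nodes V \<and> (\<forall>v\<in>nodes V. le_node V r v))"

definition max_nodes :: "'a cascade \<Rightarrow> 'a set" where
  "max_nodes V = {v \<in> nodes V. \<not> (\<exists>w\<in>nodes V. less_node V v w)}"

definition succs :: "'a cascade \<Rightarrow> 'a \<Rightarrow> 'a set" where
  "succs V v = {w \<in> nodes V. less_node V v w \<and>
                  \<not> (\<exists>x\<in>nodes V. less_node V v x \<and> less_node V x w)}"

definition sequential :: "'a cascade \<Rightarrow> bool" where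
  "sequential V \<longleftrightarrow> is_cascade V \<and>
     (\<forall>v \<in> nodes V - max_nodes V. countable (succs V v) \<and> infinite (succs V v))"

text \<open>The ranks of nodes of a sequential cascade are countable ordinals.\<close>

definition rank_node :: "'a cascade \<Rightarrow> 'a \<Rightarrow> omega1" where
  "rank_node V = wfrec {(w, v). v \<in> nodes V \<and> w \<in> succs V v}
     (\<lambda>r v. if v \<in> max_nodes V then 0 else (LEAST a. \<forall>w\<in>succs V v. r w < a))"

lemma wf_succs:
  assumes "is_cascade V"
  shows "wf {(w, v). v \<in> nodes V \<and> w \<in> succs V v}"
proof (rule ccontr)
  assume "\<not> ?thesis"
  then obtain f where f: "\<And>i. f i \<in> nodes V" "\<And>i. f (Suc i) \<in> succs V (f i)"
    unfolding wf_iff_no_infinite_down_chain by auto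
  let ?lt = "less_node V"
  have refl: "reflp_on (nodes V) (le_node V)" and asym: "antisymp_on (nodes V) (le_node V)"
    and tr: "transp_on (nodes V) (le_node V)"
    using assms by (auto simp: is_cascade_def is_tree_def)
  have lt_trans: "?lt x z" if "?lt x y" "?lt y z" "x \<in> nodes V" "y \<in> nodes V" "z \<in> nodes V" for x y z
    using that tr asym unfolding less_node_def by (metis antisymp_onD transp_onD)
  have f_less: "?lt (f i) (f j)" if "i < j" for i j
    using that
  proof (induction j)
    case (Suc j)
    have "?lt (f j) (f (Suc j))" using f(2)[of j] by (simp add: succs_def)
    with Suc show ?case using lt_trans[of "f i" "f j" "f (Suc j)"] f(1) by (cases "i = j") auto
  qed simp
  have inj: "inj f"
    by (rule linorder_injI) (use f_less in \<open>auto simp: less_node_def\<close>)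
  define A where "A = {x \<in> nodes V. \<forall>i. ?lt x (f i) \<or> x = f i \<or> ?lt (f i) x}"
  have fA: "f i \<in> A" for i
  proof -
    have "?lt (f i) (f j) \<or> f i = f j \<or> ?lt (f j) (f i)" for j
      using f_less[of i j] f_less[of j i] by (cases i j rule: linorder_cases) auto
    then show ?thesis using f(1) by (simp add: A_def)
  qed
  obtain C where C: "pred_on.maxchain A ?lt C"
    using pred_on.Hausdorff by blast
  have chC: "pred_on.chain A ?lt C" and maxC: "\<And>S. pred_on.chain A ?lt S \<Longrightarrow> C \<subseteq> S \<Longrightarrow> S = C"
    using C by (auto simp: pred_on.maxchain_def)
  have ch: "pred_on.chain A ?lt (C \<union> range f)"
    using chC fA f_less unfolding pred_on.chain_def
    by (auto simp: A_def)
  have fC: "range f \<subseteq> C"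
    using maxC[OF ch] by blast
  have "pred_on.maxchain (nodes V) ?lt C"
    unfolding pred_on.maxchain_def
  proof (intro conjI notI; (elim exE conjE)?)
    show "pred_on.chain (nodes V) ?lt C"
      using chC unfolding pred_on.chain_def A_def by auto
  next
    fix S assume S: "pred_on.chain (nodes V) ?lt S" "C \<subset> S"
    have "pred_on.chain A ?lt S"
      using S fC unfolding pred_on.chain_def A_def by (auto 0 3)
    with maxC S(2) show False by blast
  qed
  then have "finite C"
    using assms by (simp add: is_cascade_def)
  with fC inj show False
    using finite_subset range_inj_infinite by blast
qed

lemma rank_node_max: "is_cascade V \<Longrightarrow> v \<in> max_nodes V \<Longrightarrow> rank_node V v = 0"
  unfolding rank_node_def by (subst wfrec[OF wf_succs]) auto

lemma rank_node_not_max: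
  assumes "is_cascade V" "v \<in> nodes V - max_nodes V"
  shows "rank_node V v = (LEAST a. \<forall>w\<in>succs V v. rank_node V w < a)"
  using assms(2) unfolding rank_node_def
  by (subst wfrec[OF wf_succs[OF assms(1)]]) (auto simp: cut_apply)

definition cascade_rank :: "'a cascade \<Rightarrow> omega1" where
  "cascade_rank V = rank_node V (root_node V)"

definition monotone_sequential :: "'a cascade \<Rightarrow> bool" where
  "monotone_sequential V \<longleftrightarrow> sequential V \<and>
     (\<forall>v \<in> nodes V - max_nodes V.
        bij_betw (child V v) UNIV (succs V v) \<and> mono (\<lambda>n. rank_node V (child V v n)))"

definition node_at :: "'a cascade \<Rightarrow> nat list \<Rightarrow> 'a" where
  "node_at V l = foldl (child V) (root_node V) l"

inductive_set labels :: "'a cascade \<Rightarrow> nat list set" for V :: "'a cascade" where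
  Nil: "[] \<in> labels V"
| snoc: "l \<in> labels V \<Longrightarrow> node_at V l \<in> nodes V - max_nodes V \<Longrightarrow> l @ [n] \<in> labels V"

definition labels_of_rank :: "omega1 \<Rightarrow> 'a cascade \<Rightarrow> nat list set" where
  "labels_of_rank a V = {l \<in> labels V. rank_node V (node_at V l) = a}"

definition subcascade :: "'a cascade \<Rightarrow> nat list \<Rightarrow> 'a cascade" where
  "subcascade V l = V\<lparr>nodes := {w \<in> nodes V. le_node V (node_at V l) w}\<rparr>"


section \<open>Contours\<close>

definition cofinite_converges :: "'a cascade \<Rightarrow> 'a topology \<Rightarrow> bool" where
  "cofinite_converges V X \<longleftrightarrow> topspace X = nodes V \<and>
     (\<forall>v \<in> nodes V - max_nodes V. limitin X (\<lambda>w. w) v (inf cofinite (principal (succs V v))))"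

definition cascade_topology :: "'a cascade \<Rightarrow> 'a topology" where
  "cascade_topology V = (THE X. cofinite_converges V X \<and>
     (\<forall>Y. cofinite_converges V Y \<longrightarrow> (\<forall>S. openin Y S \<longrightarrow> openin X S)))"

lemma openin_cascade_topology:
  "openin (cascade_topology V) S \<longleftrightarrow>
     S \<subseteq> nodes V \<and> (\<forall>v \<in> S - max_nodes V. finite (succs V v - S))"
proof -
  define P where "P = (\<lambda>S. S \<subseteq> nodes V \<and> (\<forall>v \<in> S - max_nodes V. finite (succs V v - S)))"
  have "istopology P"
    unfolding istopology_def
  proof (intro conjI allI impI)
    fix S T assume "P S" "P T"
    then show "P (S \<inter> T)" unfolding P_def by (auto simp: Diff_Int)
  next
    fix K assume K: "\<forall>S\<in>K. P S"
    show "P (\<Union>K)" unfolding P_def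
    proof (intro conjI ballI)
      show "\<Union>K \<subseteq> nodes V" using K unfolding P_def by auto
      fix v assume "v \<in> \<Union>K - max_nodes V"
      then obtain S where "S \<in> K" "v \<in> S - max_nodes V" by blast
      then show "finite (succs V v - \<Union>K)"
        using K unfolding P_def by (meson Diff_mono Union_upper finite_subset order_refl)
    qed
  qed
  then have op: "openin (topology P) = P" by simp
  have P_nodes: "P (nodes V)"
  proof -
    have "succs V v - nodes V = {}" for v by (auto simp: succs_def)
    then show ?thesis unfolding P_def by (metis finite.emptyI order_refl)
  qed
  have ts: "topspace (topology P) = nodes V"
    using P_nodes unfolding topspace_def op by (auto simp: P_def)
  have ev: "eventually (\<lambda>w. w \<in> S) (inf cofinite (principal (succs V v))) \<longleftrightarrow> finite (succs V v - S)"
    for S v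
    by (simp add: eventually_inf_principal eventually_cofinite set_diff_eq)
  have conv: "cofinite_converges V (topology P)"
    unfolding cofinite_converges_def limitin_def ts ev op by (auto simp: P_def)
  have fin: "openin (topology P) S" if "cofinite_converges V Y" "openin Y S" for Y S
    using that openin_subset[OF that(2)]
    unfolding cofinite_converges_def limitin_def ev op by (auto simp: P_def)
  have "cascade_topology V = topology P"
    unfolding cascade_topology_def
  proof (rule the_equality)
    fix X assume "cofinite_converges V X \<and>
      (\<forall>Y. cofinite_converges V Y \<longrightarrow> (\<forall>S. openin Y S \<longrightarrow> openin X S))"
    then show "X = topology P"
      using conv fin unfolding topology_eq by blast
  qed (use conv fin in blast)
  then show ?thesis using op by (simp add: P_def)
qed

text \<open>Nodes are of type \<^typ>\<open>nat + 'a\<close>, where \<^term>\<open>Inl k\<close> stands for the natural number \<open>k\<close> itself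
  and \<^term>\<open>Inr\<close> provides arbitrary further nodes. (Sequential cascades are countable, so
  \<open>nat + nat list\<close> already accommodates all of them up to isomorphism.) Thus \<open>max V \<subseteq> \<omega>\<close> reads
  \<open>max_nodes V \<subseteq> range Inl\<close>, and \<^const>\<open>filtercomap\<close> along \<^term>\<open>Inl\<close> yields the filter on
  \<open>\<omega>\<close> generated by the trace on \<open>max V\<close>. Recall that \<open>F \<le> G\<close> for filters means that every set
  of \<open>G\<close> belongs to \<open>F\<close>.\<close>

definition leaves :: "(nat + 'a) cascade \<Rightarrow> nat set" where
  "leaves V = {k. Inl k \<in> max_nodes V}"

definition contour :: "(nat + 'a) cascade \<Rightarrow> nat filter" where
  "contour V = filtercomap Inl
     (inf (nhdsin (cascade_topology V) (root_node V)) (principal (max_nodes V)))"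

definition ultrafilter :: "'a filter \<Rightarrow> bool" where
  "ultrafilter u \<longleftrightarrow> u \<noteq> bot \<and> (\<forall>F. F \<noteq> bot \<longrightarrow> F \<le> u \<longrightarrow> F = u)"

definition E_rel ::
  "nat filter \<Rightarrow> nat \<Rightarrow> (nat + 'a) cascade \<Rightarrow> nat \<Rightarrow> (nat + 'b) cascade \<Rightarrow> bool" where
  "E_rel u n V m W \<longleftrightarrow>
     (\<forall>A B :: nat list \<Rightarrow> nat list \<Rightarrow> nat set.
        (\<forall>p \<in> labels_of_rank (ord_of_nat n) V. \<forall>s \<in> labels_of_rank (ord_of_nat m) W.
           eventually (\<lambda>x. x \<in> A p s) (contour (subcascade V p)) \<and>
           eventually (\<lambda>x. x \<in> B p s) (contour (subcascade W s))) \<longrightarrow>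
        eventually (\<lambda>x. x \<in> (\<Union>p \<in> labels_of_rank (ord_of_nat n) V.
                               \<Union>s \<in> labels_of_rank (ord_of_nat m) W. A p s \<inter> B p s)) u)"


section \<open>Increasing the order\<close>

definition less_lex :: "'a cascade \<Rightarrow> 'a \<Rightarrow> 'a \<Rightarrow> bool" where
  "less_lex V v' v'' \<longleftrightarrow> less_node V v'' v' \<or>
     (\<exists>v \<in> nodes V - max_nodes V. \<exists>n m. n < m \<and>
        le_node V (child V v n) v' \<and> le_node V (child V v m) v'')"

text \<open>The order type of the image of a set does not depend on the choice made here.\<close>

definition lex_embedding :: "'a cascade \<Rightarrow> 'a \<Rightarrow> omega1" where
  "lex_embedding V = (SOME f. \<forall>v'\<in>max_nodes V. \<forall>v''\<in>max_nodes V.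
     less_lex V v' v'' \<longleftrightarrow> f v' < f v'')"

definition increases_order :: "(nat + 'b) cascade \<Rightarrow> (nat + 'a) cascade \<Rightarrow> bool" where
  "increases_order W V \<longleftrightarrow> leaves W \<subseteq> leaves V \<and>
     (\<forall>U \<subseteq> leaves W.
        ot (lex_embedding W ` Inl ` U) \<ge> indec (ot (lex_embedding V ` Inl ` U)))"

end

theory Submission
  imports Defs
begin

text \<open>Compare functions on \<open>\<omega>\<close> by \<open>f \<preceq> g\<close> iff \<open>f \<le> h \<circ> g\<close> on a set of \<open>u\<close> for some \<open>h\<close>;
  for an ultrafilter this preorder is total. A cascade \<open>V\<close> of rank \<open>r\<close> with \<open>\<integral>V \<subseteq> u\<close> assigns to
  almost every leaf its ancestors \<open>c\<^sub>0, \<dots>, c\<^sub>r\<close>, and \<open>\<integral>V \<subseteq> u\<close> says that this chain is strictly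
  \<open>\<preceq>\<close>-increasing; likewise \<open>W\<close> gives \<open>d\<^sub>0, \<dots>, d\<^sub>s\<close>. Sorting both chains into one and
  pairing them yields a chain of at most \<open>r + s\<close> steps, whose level sets, restricted to a suitable
  set of \<open>u\<close>, are the nodes of \<open>T\<close>. Above a node of \<open>T\<close>, each next ancestor in \<open>V\<close> or \<open>W\<close> leaves only
  finitely many possible successors in \<open>T\<close>. Hence open sets of \<open>V\<close> pull back to open sets of \<open>T\<close>,
  and the nested infinite branchings which witness an order type \<open>\<ge> \<omega> ^ k\<close> in \<open>V\<close> reappear in \<open>T\<close>.\<close>

section \<open>Arithmetic of countable ordinals\<close>

text \<open>The preorder compares functions into \<open>nat\<close>, so a node is replaced by the
  least selected leaf above it. On those leaves the bottom of each chain is then constant and the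
  top is the identity, and both chains share their least and greatest classes. Since the preorder is
  total, a pair is equivalent to the larger of its two entries: pairing costs nothing in the
  sorting, but its value determines a node of \<open>V\<close> and a node of \<open>W\<close> at
  once. Every step of the merge moves at least one chain and neither by more than one place, which
  gives both rank bounds. Domination holds only modulo \<open>u\<close>, while a tree needs
  infinitely many successors at every node; so the leaves have to be thinned until the inequalities
  hold pointwise and every remaining node branches infinitely. For the orders, the finite rank of
  \<open>T\<close> keeps all types below \<omega>^\<omega>, where \<open>indec\<close> yields the
  largest power of \<omega> not above. Reaching \<omega>^k is a property of the tree that does not
  involve the enumerations, and therefore \<open>T\<close> may enumerate its successors
  arbitrarily.\<close>

lemma omega1_zero_le [simp]: "(0 :: omega1) \<le> a"
  unfolding zero_omega1_def by (rule Least_le) simp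

lemma omega1_not_less_zero [simp]: "\<not> a < (0 :: omega1)"
  by (simp add: not_less)

lemma omega1_pos_iff: "0 < (a :: omega1) \<longleftrightarrow> a \<noteq> 0"
  using omega1_zero_le[of a] by (auto simp: less_le simp del: omega1_zero_le)

lemma ord_of_nat_less_Suc: "ord_of_nat n < ord_of_nat (Suc n)"
proof -
  have "\<exists>c. ord_of_nat n < c"
    using countable_bounded_omega1[of "{ord_of_nat n}"] by auto
  then show ?thesis by (auto intro: LeastI_ex)
qed

lemma ord_of_nat_Suc_le: "ord_of_nat n < a \<Longrightarrow> ord_of_nat (Suc n) \<le> a"
  by (auto intro: Least_le)

declare ord_of_nat.simps(2) [simp del]

lemma less_ord_of_nat_Suc: "a < ord_of_nat (Suc n) \<longleftrightarrow> a \<le> ord_of_nat n"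
  using ord_of_nat_Suc_le[of n a] ord_of_nat_less_Suc[of n] by (meson leD leI le_less_trans)

lemma strict_mono_ord_of_nat: "strict_mono ord_of_nat"
  by (simp add: strict_mono_Suc_iff ord_of_nat_less_Suc)

text \<open>The values to be exceeded form a countable set, which is bounded, so the
  \<open>LEAST\<close> in the definition is attained. These three properties replace the recursion
  equation from here on.\<close>

lemma plus_omega1_bounds:
  fixes a b :: omega1
  shows plus_omega1_ge: "a \<le> a + b"
    and plus_omega1_strict_mono: "b' < b \<Longrightarrow> a + b' < a + b"
    and plus_omega1_least: "a \<le> c \<Longrightarrow> (\<And>b'. b' < b \<Longrightarrow> a + b' < c) \<Longrightarrow> a + b \<le> c"
proof -
  let ?P = "\<lambda>c. a \<le> c \<and> (\<forall>b'\<in>{..<b}. a + b' < c)"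
  have "countable (insert a ((+) a ` {..<b}))"
    using countable_lessThan_omega1 by simp
  from countable_bounded_omega1[OF this] have "\<exists>c. ?P c"
    by (meson image_eqI insertI1 insertI2 less_imp_le)
  from LeastI_ex[OF this] have P: "?P (a + b)"
    unfolding plus_omega1.simps[of a b, symmetric] .
  show "a \<le> a + b" "b' < b \<Longrightarrow> a + b' < a + b"
    using P by auto
  assume "a \<le> c" "\<And>b'. b' < b \<Longrightarrow> a + b' < c"
  then show "a + b \<le> c"
    by (subst plus_omega1.simps) (auto intro: Least_le)
qed

lemma plus_omega1_less_cancel [simp]: "(a :: omega1) + b < a + c \<longleftrightarrow> b < c"
  using plus_omega1_strict_mono[of b c a] plus_omega1_strict_mono[of c b a]
  by (metis less_irrefl less_trans linorder_less_linear)

lemma plus_omega1_le_cancel [simp]: "(a :: omega1) + b \<le> a + c \<longleftrightarrow> b \<le> c"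
  by (metis not_less plus_omega1_less_cancel)

lemma plus_omega1_zero [simp]: "(a :: omega1) + 0 = a"
  by (rule antisym[OF plus_omega1_least plus_omega1_ge]) auto

lemma plus_omega1_ge_right: "(b :: omega1) \<le> a + b"
proof (induction b rule: less_induct)
  case (less b)
  then have "b' < a + b" if "b' < b" for b'
    using that plus_omega1_strict_mono[of b' b a] by (meson le_less_trans)
  then show ?case using not_less by blast
qed

lemma zero_plus_omega1 [simp]: "(0 :: omega1) + b = b"
proof (induction b rule: less_induct)
  case (less b)
  then show ?case
    by (intro antisym plus_omega1_least plus_omega1_ge_right) auto
qed

lemma plus_omega1_mono_left: "(a :: omega1) \<le> a' \<Longrightarrow> a + b \<le> a' + b"
proof (induction b rule: less_induct)
  case (less b)
  show ?case
  proof (rule plus_omega1_least)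
    show "a \<le> a' + b" using less.prems plus_omega1_ge by (rule order_trans)
    show "a + b' < a' + b" if "b' < b" for b'
      using less.IH[OF that less.prems] plus_omega1_strict_mono[OF that] by (rule le_less_trans)
  qed
qed

lemma plus_omega1_mono: "(a :: omega1) \<le> a' \<Longrightarrow> b \<le> b' \<Longrightarrow> a + b \<le> a' + b'"
  by (rule order_trans[OF plus_omega1_mono_left[of a a' b] iffD2[OF plus_omega1_le_cancel[of a' b b']]])

text \<open>Left subtraction: the least \<open>b\<close> with \<open>c \<le> a + b\<close> works,
  because every smaller summand leaves the sum below \<open>c\<close>.\<close>

lemma omega1_le_plusD:
  assumes "(a :: omega1) \<le> c"
  obtains b where "c = a + b"
proof
  define b where "b = (LEAST b. c \<le> a + b)"
  have "c \<le> a + b"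
    unfolding b_def by (rule LeastI[of _ c]) (rule plus_omega1_ge_right)
  moreover have "a + b \<le> c"
    using assms
  proof (rule plus_omega1_least)
    show "a + b' < c" if "b' < b" for b'
      using not_less_Least[OF that[unfolded b_def]] by (simp add: not_le)
  qed
  ultimately show "c = a + b" by simp
qed

lemma plus_omega1_assoc: "(a :: omega1) + b + c = a + (b + c)"
proof (induction c rule: less_induct)
  case (less c)
  show ?case
  proof (rule antisym)
    show "a + b + c \<le> a + (b + c)"
      by (rule plus_omega1_least) (auto simp: plus_omega1_ge less)
    show "a + (b + c) \<le> a + b + c"
    proof (rule plus_omega1_least)
      show "a \<le> a + b + c" using plus_omega1_ge order_trans by blast
      fix d assume d: "d < b + c"
      show "a + d < a + b + c"
      proof (cases "d < b")
        case True
        then have "a + d < a + b" by simp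
        also have "\<dots> \<le> a + b + c" by (rule plus_omega1_ge)
        finally show ?thesis .
      next
        case False
        then obtain c' where c': "d = b + c'" by (metis not_less omega1_le_plusD)
        with d have "c' < c" by simp
        then show ?thesis using less[of c'] c' by (metis plus_omega1_strict_mono)
      qed
    qed
  qed
qed

text \<open>Turns the bound on the number of levels of the merged tree into the upper bound on its
  ordinal rank.\<close>

lemma ord_of_nat_add_le: "ord_of_nat (a + b) \<le> ord_of_nat a + ord_of_nat b"
proof (induction b)
  case (Suc b)
  also have "ord_of_nat a + ord_of_nat b < ord_of_nat a + ord_of_nat (Suc b)"
    by (simp add: ord_of_nat_less_Suc)
  finally show ?case by (simp add: ord_of_nat_Suc_le)
qed simp

section \<open>Finite powers of \<omega> and indecomposable ordinals\<close>

primrec times_nat_omega1 :: "omega1 \<Rightarrow> nat \<Rightarrow> omega1" where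
  "times_nat_omega1 a 0 = 0"
| "times_nat_omega1 a (Suc m) = times_nat_omega1 a m + a"

lemma times_nat_omega1_add:
  "times_nat_omega1 a (m + k) = times_nat_omega1 a m + times_nat_omega1 a k"
  by (induction k) (simp_all add: plus_omega1_assoc)

primrec omega_power :: "nat \<Rightarrow> omega1" where
  "omega_power 0 = ord_of_nat 1"
| "omega_power (Suc k) = (LEAST a. \<forall>m. times_nat_omega1 (omega_power k) m \<le> a)"

lemma times_nat_le_omega_power: "times_nat_omega1 (omega_power k) m \<le> omega_power (Suc k)"
proof -
  have "countable (range (times_nat_omega1 (omega_power k)))" by simp
  from countable_bounded_omega1[OF this]
  have "\<exists>a. \<forall>m. times_nat_omega1 (omega_power k) m \<le> a" by (meson less_imp_le rangeI)
  from LeastI_ex[OF this] show ?thesis by simp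
qed

lemma omega_power_Suc_le:
  "(\<And>m. times_nat_omega1 (omega_power k) m \<le> a) \<Longrightarrow> omega_power (Suc k) \<le> a"
  by (simp add: Least_le)

declare omega_power.simps [simp del]

lemma omega_power_pos: "0 < omega_power k"
proof (induction k)
  case 0
  show ?case using ord_of_nat_less_Suc[of 0] by (simp add: omega_power.simps)
next
  case (Suc k)
  also have "omega_power k \<le> omega_power (Suc k)"
    using times_nat_le_omega_power[of k 1] by simp
  finally show ?case .
qed

lemma omega_power_less_Suc: "omega_power k < omega_power (Suc k)"
proof -
  have "omega_power k + 0 < omega_power k + omega_power k"
    using omega_power_pos by (simp only: plus_omega1_less_cancel)
  also have "\<dots> \<le> omega_power (Suc k)"
    using times_nat_le_omega_power[of k 2] by (simp add: numeral_2_eq_2)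
  finally show ?thesis by simp
qed

lemma strict_mono_omega_power: "strict_mono omega_power"
  by (simp add: strict_mono_Suc_iff omega_power_less_Suc)

text \<open>Two ordinals below a positive power lie below finite multiples of the previous power,
  and the sum of these is again such a multiple.\<close>

lemma indecomposable_omega_power: "indecomposable (omega_power k)"
  unfolding indecomposable_def
proof (intro conjI allI impI)
  show "omega_power k \<noteq> 0" using omega_power_pos[of k] by simp
  fix b c assume bc: "b < omega_power k" "c < omega_power k"
  show "b + c < omega_power k"
  proof (cases k)
    case 0
    then have "b = 0" "c = 0"
      using bc less_ord_of_nat_Suc[of _ 0] by (simp_all add: antisym omega_power.simps)
    then show ?thesis using omega_power_pos by simp
  next
    case (Suc k')
    let ?t = "times_nat_omega1 (omega_power k')"
    have *: "\<exists>m. a < ?t m" if "a < omega_power k" for a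
      using that omega_power_Suc_le[of k' a] Suc by (meson leD not_le)
    then obtain m1 m2 where m: "b < ?t m1" "c < ?t m2" using bc by blast
    have "b + c \<le> ?t m1 + c" using m by (intro plus_omega1_mono) auto
    also have "\<dots> < ?t m1 + ?t m2" using m by simp
    also have "\<dots> \<le> omega_power k"
      using times_nat_le_omega_power[of k' "m1 + m2"] Suc by (simp add: times_nat_omega1_add)
    finally show ?thesis .
  qed
qed

text \<open>By indecomposability all finite multiples of \<open>omega_power k\<close> stay below
  \<open>b\<close>. So no indecomposable ordinal lies strictly between consecutive powers, which
  pins down \<open>indec\<close> below \<omega>^\<omega>.\<close>

lemma indecomposable_omega_power_less:
  assumes "indecomposable b" "omega_power k < b"
  shows "omega_power (Suc k) \<le> b"
proof (rule omega_power_Suc_le)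
  fix m
  have "times_nat_omega1 (omega_power k) m < b"
    using assms by (induction m) (auto simp: indecomposable_def omega1_pos_iff)
  then show "times_nat_omega1 (omega_power k) m \<le> b" by simp
qed

lemma indec_eq_omega_power:
  assumes "omega_power j \<le> a" "a < omega_power (Suc j)"
  shows "indec a = omega_power j"
proof -
  have "a \<noteq> 0" using assms(1) omega_power_pos[of j] by (auto simp: not_le)
  moreover have "(GREATEST b. indecomposable b \<and> b \<le> a) = omega_power j"
  proof (rule Greatest_equality)
    show "indecomposable (omega_power j) \<and> omega_power j \<le> a"
      using assms indecomposable_omega_power by blast
    show "b \<le> omega_power j" if "indecomposable b \<and> b \<le> a" for b
      using that assms(2) indecomposable_omega_power_less[of b j] by (meson leD not_le order_trans)
  qed
  ultimately show ?thesis by (simp add: indec_def)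
qed

lemma indec_omega_power_cases:
  assumes "a < omega_power k"
  shows "a = 0 \<or> (\<exists>j<k. indec a = omega_power j)"
proof (cases "a = 0")
  case False
  define i where "i = (LEAST i. a < omega_power i)"
  have i: "a < omega_power i" unfolding i_def using assms by (rule LeastI)
  have "i \<le> k" unfolding i_def using assms by (rule Least_le)
  have "i \<noteq> 0"
    using False i less_ord_of_nat_Suc[of a 0] by (metis One_nat_def antisym omega1_zero_le omega_power.simps(1) ord_of_nat.simps(1))
  then obtain j where j: "i = Suc j" using not0_implies_Suc by blast
  then have "\<not> a < omega_power j" using not_less_Least[of j "\<lambda>i. a < omega_power i"] unfolding i_def by simp
  then show ?thesis using i j \<open>i \<le> k\<close> indec_eq_omega_power[of j a] by (metis Suc_le_lessD not_less)
qed simp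


section \<open>Order types of countable sets of countable ordinals\<close>

lemma strict_mono_on_lessThan_ge:
  assumes "strict_mono_on {..<a} (h :: omega1 \<Rightarrow> omega1)" "x < a"
  shows "x \<le> h x"
  using assms(2)
proof (induction x rule: less_induct)
  case (less x)
  show ?case
  proof (rule ccontr)
    assume "\<not> x \<le> h x"
    then have hx: "h x < x" by simp
    with less have "h x \<le> h (h x)" by auto
    moreover have "h (h x) < h x"
      using strict_mono_onD[OF assms(1), of "h x" x] hx less.prems by auto
    ultimately show False by simp
  qed
qed

lemma strict_mono_on_lessThan_le:
  assumes "strict_mono_on {..<a} (h :: omega1 \<Rightarrow> omega1)" "h ` {..<a} \<subseteq> {..<b}"
  shows "a \<le> b"
proof (rule ccontr)
  assume "\<not> a \<le> b"
  then have "b < a" by simp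
  with strict_mono_on_lessThan_ge[OF assms(1) this] assms(2) show False by force
qed

lemma strict_mono_on_bij_betw_inv:
  fixes g :: "'a :: linorder \<Rightarrow> 'b :: linorder"
  assumes "bij_betw g A B" "strict_mono_on A g"
  shows "strict_mono_on B (inv_into A g)"
proof (rule strict_mono_onI)
  fix x y assume "x \<in> B" "y \<in> B" "x < y"
  then have *: "inv_into A g x \<in> A" "inv_into A g y \<in> A"
    "g (inv_into A g x) = x" "g (inv_into A g y) = y"
    using assms(1) by (auto simp: bij_betw_def inv_into_into f_inv_into_f)
  show "inv_into A g x < inv_into A g y"
    using * strict_mono_onD[OF assms(2), of "inv_into A g y" "inv_into A g x"] \<open>x < y\<close>
    by (metis less_irrefl less_trans linorder_less_linear)
qed

text \<open>Conjugating \<open>h\<close> with the two isomorphisms gives a strictly increasing map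
  between initial segments, and such a map never moves a point down. The case \<open>h = id\<close>
  yields both uniqueness and monotonicity of \<open>ot\<close>.\<close>

lemma order_iso_lessThan_le:
  fixes g :: "omega1 \<Rightarrow> omega1"
  assumes "bij_betw g A {..<a}" "strict_mono_on A g" "bij_betw g' B {..<b}" "strict_mono_on B g'"
    and "strict_mono_on A h" "h ` A \<subseteq> B"
  shows "a \<le> (b :: omega1)"
proof (rule strict_mono_on_lessThan_le)
  let ?i = "inv_into A g"
  have i: "?i x \<in> A" if "x < a" for x
    using that assms(1) by (auto simp: bij_betw_def intro!: inv_into_into)
  show "strict_mono_on {..<a} (g' \<circ> h \<circ> ?i)"
  proof (rule strict_mono_onI)
    fix x y assume "x \<in> {..<a}" "y \<in> {..<a}" "x < y"
    then have "h (?i x) < h (?i y)"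
      using i strict_mono_onD[OF assms(5)] strict_mono_onD[OF strict_mono_on_bij_betw_inv[OF assms(1,2)]]
      by auto
    then show "(g' \<circ> h \<circ> ?i) x < (g' \<circ> h \<circ> ?i) y"
      using i \<open>x \<in> _\<close> \<open>y \<in> _\<close> assms(6) by (auto intro!: strict_mono_onD[OF assms(4)])
  qed
  show "(g' \<circ> h \<circ> ?i) ` {..<a} \<subseteq> {..<b}"
    using i assms(3,6) by (fastforce simp: bij_betw_def)
qed

lemma ot_eqI:
  assumes "bij_betw g A {..<a}" "strict_mono_on A g"
  shows "ot A = a"
  unfolding ot_def
proof (rule the_equality)
  show "\<exists>g. bij_betw g A {..<a} \<and> strict_mono_on A g" using assms by blast
  fix b :: omega1 assume "\<exists>g. bij_betw g A {..<b} \<and> strict_mono_on A g"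
  then obtain g' where "bij_betw g' A {..<b}" "strict_mono_on A g'" by blast
  with assms show "b = a"
    using order_iso_lessThan_le[of _ A _ _ A _ id] by (intro antisym) (auto simp: strict_mono_on_def)
qed

text \<open>The Mostowski collapse of \<open>A\<close>, also given at points outside
  \<open>A\<close>. Its values on \<open>A\<close> form an initial segment.\<close>

function collapse :: "omega1 set \<Rightarrow> omega1 \<Rightarrow> omega1" where
  "collapse A x = (LEAST c. \<forall>y\<in>A \<inter> {..<x}. collapse A y < c)"
  by auto
termination
  by (relation "inv_image {(x, y). x < y} snd") (auto intro: wf)

declare collapse.simps [simp del]

lemma collapse_less:
  assumes "y \<in> A" "y < x"
  shows "collapse A y < collapse A x"
proof -
  have "countable (collapse A ` (A \<inter> {..<x}))"
    using countable_lessThan_omega1[of x] by (simp add: countable_Int2)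
  from countable_bounded_omega1[OF this]
  have "\<exists>c. \<forall>y\<in>A \<inter> {..<x}. collapse A y < c" by auto
  from LeastI_ex[OF this] show ?thesis
    using assms by (subst (2) collapse.simps) auto
qed

lemma collapse_downward:
  assumes "c < collapse A x"
  shows "c \<in> collapse A ` A"
  using assms
proof (induction x rule: less_induct)
  case (less x)
  have "\<not> (\<forall>y\<in>A \<inter> {..<x}. collapse A y < c)"
    using less.prems not_less_Least[of c "\<lambda>c. \<forall>y\<in>A \<inter> {..<x}. collapse A y < c"]
    by (simp only: collapse.simps[of A x, symmetric] not_False_eq_True)
  then obtain y where y: "y \<in> A" "y < x" "c \<le> collapse A y" by (auto simp: not_less)
  then show ?case using less.IH[of y] by (cases "c = collapse A y") auto
qed

lemma countable_ot_iso:
  assumes "countable A"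
  obtains g where "bij_betw g A {..<ot A}" "strict_mono_on A g"
proof -
  have sm: "strict_mono_on A (collapse A)"
    by (rule strict_mono_onI) (rule collapse_less)
  define a where "a = (LEAST a. \<forall>x\<in>A. collapse A x < a)"
  have "countable (collapse A ` A)" using assms by simp
  from countable_bounded_omega1[OF this] have "\<exists>a. \<forall>x\<in>A. collapse A x < a" by auto
  from LeastI_ex[OF this] have ub: "\<forall>x\<in>A. collapse A x < a" unfolding a_def .
  have "collapse A ` A = {..<a}"
  proof (intro equalityI subsetI)
    fix c assume "c \<in> {..<a}"
    then have "c < a" by simp
    then obtain x where x: "x \<in> A" "c \<le> collapse A x"
      using not_less_Least[of c "\<lambda>a. \<forall>x\<in>A. collapse A x < a"] unfolding a_def by (auto simp: not_less)
    then show "c \<in> collapse A ` A"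
      using collapse_downward[of c A x] by (cases "c = collapse A x") auto
  qed (use ub in auto)
  then have b: "bij_betw (collapse A) A {..<a}"
    using strict_mono_on_imp_inj_on[OF sm] by (simp add: bij_betw_def)
  with sm show ?thesis using that[of "collapse A"] ot_eqI[OF b sm] by simp
qed

lemma ot_mono:
  assumes "countable B" "A \<subseteq> B"
  shows "ot A \<le> ot B"
proof -
  obtain g where "bij_betw g A {..<ot A}" "strict_mono_on A g"
    using countable_ot_iso countable_subset[OF assms(2,1)] by blast
  moreover obtain g' where "bij_betw g' B {..<ot B}" "strict_mono_on B g'"
    using countable_ot_iso assms(1) by blast
  ultimately show ?thesis
    using assms(2) by (intro order_iso_lessThan_le[of g A _ g' B _ id]) (auto simp: strict_mono_on_def)
qed

lemma ot_empty [simp]: "ot {} = 0"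
  by (rule ot_eqI[of id]) (auto simp: bij_betw_def)

lemma ot_pos:
  assumes "countable A" "A \<noteq> {}"
  shows "0 < ot A"
proof -
  obtain g where "bij_betw g A {..<ot A}"
    using countable_ot_iso assms(1) by blast
  with assms(2) have "{..<ot A} \<noteq> {}" by (auto simp: bij_betw_def)
  then show ?thesis by (auto simp: omega1_pos_iff)
qed

text \<open>Otherwise some element of \<open>A\<close> sits at position \<open>b\<close> and has a
  set of predecessors of type exactly \<open>b\<close>.\<close>

lemma ot_leI:
  assumes "countable A" "\<And>x. x \<in> A \<Longrightarrow> ot (A \<inter> {..<x}) < b"
  shows "ot A \<le> b"
proof (rule ccontr)
  assume "\<not> ot A \<le> b"
  then have "b < ot A" by simp
  obtain g where g: "bij_betw g A {..<ot A}" "strict_mono_on A g"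
    using countable_ot_iso assms(1) by blast
  obtain x where x: "x \<in> A" "g x = b"
    using \<open>b < ot A\<close> g(1) by (metis bij_betw_imp_surj_on imageE lessThan_iff)
  have "ot (A \<inter> {..<x}) = g x"
  proof (rule ot_eqI)
    show "strict_mono_on (A \<inter> {..<x}) g"
      using g(2) by (auto simp: strict_mono_on_def)
    have "g ` (A \<inter> {..<x}) = {..<g x}"
    proof (intro equalityI subsetI)
      fix c assume "c \<in> {..<g x}"
      then have c: "c < g x" by simp
      with \<open>b < ot A\<close> x(2) have "c \<in> g ` A" using g(1) by (auto simp: bij_betw_def)
      then obtain y where y: "y \<in> A" "c = g y" by blast
      have "y < x"
        using c y x(1) strict_mono_onD[OF g(2), of x y] by (metis less_asym less_irrefl linorder_less_linear)
      with y show "c \<in> g ` (A \<inter> {..<x})" by blast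
    qed (use x(1) strict_mono_onD[OF g(2)] in auto)
    then show "bij_betw g (A \<inter> {..<x}) {..<g x}"
      using g(1) by (auto simp: bij_betw_def intro: inj_on_subset)
  qed
  with assms(2)[OF x(1)] x(2) show False by simp
qed

lemma ot_Un:
  assumes "countable A" "countable B" "\<And>x y. x \<in> A \<Longrightarrow> y \<in> B \<Longrightarrow> x < y"
  shows "ot (A \<union> B) = ot A + ot B"
proof -
  obtain g where g: "bij_betw g A {..<ot A}" "strict_mono_on A g"
    using countable_ot_iso assms(1) by blast
  obtain h where h: "bij_betw h B {..<ot B}" "strict_mono_on B h"
    using countable_ot_iso assms(2) by blast
  define k where "k = (\<lambda>x. if x \<in> A then g x else ot A + h x)"
  have disj: "x \<notin> A" if "x \<in> B" for x using assms(3) that by blast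
  have gA: "g x < ot A" if "x \<in> A" for x using g(1) that by (auto simp: bij_betw_def)
  have hB: "h x < ot B" if "x \<in> B" for x using h(1) that by (auto simp: bij_betw_def)
  have sm: "strict_mono_on (A \<union> B) k"
  proof (rule strict_mono_onI)
    fix x y assume xy: "x \<in> A \<union> B" "y \<in> A \<union> B" "x < y"
    consider "x \<in> A" "y \<in> A" | "x \<in> A" "y \<in> B" | "x \<in> B" "y \<in> B"
      using xy assms(3)[of y x] by (auto dest: less_asym)
    then show "k x < k y"
    proof cases
      case 1
      then show ?thesis using xy strict_mono_onD[OF g(2)] by (simp add: k_def)
    next
      case 2
      have "g x < ot A" using gA 2 by simp
      also have "\<dots> \<le> ot A + h y" by (rule plus_omega1_ge)
      finally show ?thesis using 2 disj by (simp add: k_def)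
    next
      case 3
      then show ?thesis using xy disj strict_mono_onD[OF h(2)] by (simp add: k_def)
    qed
  qed
  have "k ` (A \<union> B) = {..<ot A + ot B}"
  proof (intro equalityI subsetI)
    fix c assume "c \<in> k ` (A \<union> B)"
    then show "c \<in> {..<ot A + ot B}"
      using gA hB less_le_trans[OF gA plus_omega1_ge] by (auto simp: k_def)
  next
    fix c assume "c \<in> {..<ot A + ot B}"
    then have c: "c < ot A + ot B" by simp
    show "c \<in> k ` (A \<union> B)"
    proof (cases "c < ot A")
      case True
      then have "c \<in> g ` A" using g(1) by (auto simp: bij_betw_def)
      then show ?thesis by (auto simp: k_def)
    next
      case False
      then obtain d where d: "c = ot A + d" by (metis not_less omega1_le_plusD)
      with c have "d \<in> h ` B" using h(1) by (auto simp: bij_betw_def)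
      then show ?thesis using d disj by (force simp: k_def)
    qed
  qed
  with sm show ?thesis
    by (intro ot_eqI[of k]) (auto simp: bij_betw_def intro: strict_mono_on_imp_inj_on)
qed

section \<open>Monotone sequential cascades\<close>

text \<open>The working description of contours: an open set around the root, tested only at the
  leaves it contains.\<close>

lemma eventually_contour:
  assumes "root_node V \<in> nodes V"
  shows "eventually P (contour V) \<longleftrightarrow>
    (\<exists>S. openin (cascade_topology V) S \<and> root_node V \<in> S \<and> (\<forall>x. Inl x \<in> S \<inter> max_nodes V \<longrightarrow> P x))"
proof -
  have "topspace (cascade_topology V) = nodes V"
  proof (rule antisym)
    show "topspace (cascade_topology V) \<subseteq> nodes V"
      using openin_cascade_topology[of V "topspace (cascade_topology V)"] by auto
    have "openin (cascade_topology V) (nodes V)"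
    proof -
      have "succs V v - nodes V = {}" for v by (auto simp: succs_def)
      then show ?thesis unfolding openin_cascade_topology by (metis finite.emptyI order_refl)
    qed
    then show "nodes V \<subseteq> topspace (cascade_topology V)" by (rule openin_subset)
  qed
  then have ev: "eventually Q (nhdsin (cascade_topology V) (root_node V)) \<longleftrightarrow>
      (\<exists>S. openin (cascade_topology V) S \<and> root_node V \<in> S \<and> (\<forall>x\<in>S. Q x))" for Q
    using assms by (simp add: eventually_nhdsin)
  show ?thesis
    unfolding contour_def eventually_filtercomap eventually_inf_principal ev
  proof safe
    fix S
    assume S: "openin (cascade_topology V) S" "root_node V \<in> S" "\<forall>x. Inl x \<in> S \<inter> max_nodes V \<longrightarrow> P x"
    show "\<exists>Q. (\<exists>S. openin (cascade_topology V) S \<and> root_node V \<in> S \<and> (\<forall>x\<in>S. x \<in> max_nodes V \<longrightarrow> Q x)) \<and>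
        (\<forall>x. Q (Inl x) \<longrightarrow> P x)"
      using S by (intro exI[of _ "\<lambda>z. z \<in> S \<inter> max_nodes V"]) auto
  qed blast
qed

locale sequential_cascade =
  fixes V :: "(nat + 'a) cascade"
  assumes mono_seq: "monotone_sequential V" and max_Inl: "max_nodes V \<subseteq> range Inl"
begin

lemma cascade: "is_cascade V"
  using mono_seq by (simp add: monotone_sequential_def sequential_def)

lemma le_refl: "v \<in> nodes V \<Longrightarrow> le_node V v v"
  using cascade unfolding is_cascade_def is_tree_def by (meson reflp_onD)

lemma le_antisym: "le_node V v w \<Longrightarrow> le_node V w v \<Longrightarrow> v \<in> nodes V \<Longrightarrow> w \<in> nodes V \<Longrightarrow> v = w"
  using cascade unfolding is_cascade_def is_tree_def by (meson antisymp_onD)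

lemma le_trans:
  "le_node V v w \<Longrightarrow> le_node V w x \<Longrightarrow> v \<in> nodes V \<Longrightarrow> w \<in> nodes V \<Longrightarrow> x \<in> nodes V \<Longrightarrow> le_node V v x"
  using cascade unfolding is_cascade_def is_tree_def by (meson transp_onD)

lemma comparable:
  assumes "le_node V v x" "le_node V w x" "v \<in> nodes V" "w \<in> nodes V" "x \<in> nodes V"
  shows "le_node V v w \<or> le_node V w v"
proof (cases "v = x \<or> w = x \<or> v = w")
  case True
  then show ?thesis using assms le_refl by auto
next
  case False
  have "totalp_on {w \<in> nodes V. less_node V w x} (less_node V)"
    using cascade assms(5) unfolding is_cascade_def is_tree_def by blast
  from totalp_onD[OF this, of v w] show ?thesis
    using False assms by (auto simp: less_node_def)
qed

lemma root: "root_node V \<in> nodes V" "v \<in> nodes V \<Longrightarrow> le_node V (root_node V) v"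
proof -
  obtain r where r: "r \<in> nodes V" "\<And>v. v \<in> nodes V \<Longrightarrow> le_node V r v"
    using cascade unfolding is_cascade_def by blast
  then have "root_node V = r"
    unfolding root_node_def using le_antisym by (intro the_equality) blast+
  with r show "root_node V \<in> nodes V" "v \<in> nodes V \<Longrightarrow> le_node V (root_node V) v" by auto
qed

lemma succsD:
  assumes "w \<in> succs V v"
  shows "w \<in> nodes V" "le_node V v w" "v \<noteq> w"
    "\<And>x. x \<in> nodes V \<Longrightarrow> le_node V v x \<Longrightarrow> le_node V x w \<Longrightarrow> x = v \<or> x = w"
  using assms by (auto simp: succs_def less_node_def)

lemma succs_parent_unique:
  assumes "w \<in> succs V v" "w \<in> succs V v'" "v \<in> nodes V" "v' \<in> nodes V"
  shows "v = v'"
  using comparable[of v w v'] assms succsD by metis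

lemma succs_unique_below:
  assumes "w \<in> succs V v" "w' \<in> succs V v" "le_node V w x" "le_node V w' x" "v \<in> nodes V" "x \<in> nodes V"
  shows "w = w'"
  using comparable[of w x w'] assms succsD by metis

text \<open>The nodes below \<open>x\<close> are well-founded, so the open interval between
  \<open>v\<close> and \<open>x\<close> has a minimal element unless it is empty, and then
  \<open>x\<close> itself is a successor.\<close>

lemma ex_succs_below:
  assumes "v \<in> nodes V" "x \<in> nodes V" "le_node V v x" "v \<noteq> x"
  obtains w where "w \<in> succs V v" "le_node V w x"
proof -
  define S where "S = {z \<in> nodes V. less_node V v z \<and> less_node V z x}"
  have wf: "wfp_on {w \<in> nodes V. less_node V w x} (less_node V)"
    using cascade assms(2) unfolding is_cascade_def is_tree_def by blast
  show thesis
  proof (cases "S = {}")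
    case True
    then have "x \<in> succs V v"
      using assms by (auto simp: succs_def less_node_def S_def)
    then show ?thesis using that le_refl assms by blast
  next
    case False
    then obtain z where z: "z \<in> S" "\<forall>y. less_node V y z \<longrightarrow> y \<notin> S"
      using wf unfolding wfp_on_iff_ex_minimal S_def by (smt (verit, best) mem_Collect_eq subsetI)
    have "z \<in> succs V v"
      using z le_trans[of _ z x] le_antisym[of _ z] assms
      unfolding succs_def S_def less_node_def by (smt (verit) mem_Collect_eq)
    then show ?thesis using that z(1) by (auto simp: S_def less_node_def)
  qed
qed

lemma le_max: "x \<in> max_nodes V \<Longrightarrow> w \<in> nodes V \<Longrightarrow> le_node V x w \<Longrightarrow> w = x"
  by (auto simp: max_nodes_def less_node_def)

lemma max_nodesD: "x \<in> max_nodes V \<Longrightarrow> x \<in> nodes V"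
  by (simp add: max_nodes_def)

lemma child_bij: "v \<in> nodes V - max_nodes V \<Longrightarrow> bij_betw (child V v) UNIV (succs V v)"
  using mono_seq by (simp add: monotone_sequential_def)

lemma child_succs: "v \<in> nodes V - max_nodes V \<Longrightarrow> child V v n \<in> succs V v"
  using child_bij by (auto simp: bij_betw_def)

lemma child_unique:
  assumes "v \<in> nodes V - max_nodes V" "le_node V (child V v n) x" "le_node V (child V v m) x" "x \<in> nodes V"
  shows "n = m"
proof -
  have "child V v n = child V v m"
    using succs_unique_below[OF child_succs child_succs] assms by blast
  then show ?thesis using child_bij[OF assms(1)] by (auto simp: bij_betw_def inj_on_def)
qed

lemma ex_child_below:
  assumes "v \<in> nodes V - max_nodes V" "x \<in> max_nodes V" "le_node V v x"
  obtains n where "le_node V (child V v n) x"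
proof -
  have "x \<in> nodes V" "v \<noteq> x" using assms by (auto simp: max_nodes_def)
  then obtain w where "w \<in> succs V v" "le_node V w x"
    using ex_succs_below assms by blast
  then show thesis using that child_bij[OF assms(1)] by (metis bij_betw_imp_surj_on imageE)
qed

lemma node_induct [consumes 1, case_names max not_max]:
  assumes "v \<in> nodes V"
    and "\<And>v. v \<in> max_nodes V \<Longrightarrow> P v"
    and "\<And>v. v \<in> nodes V - max_nodes V \<Longrightarrow> (\<And>w. w \<in> succs V v \<Longrightarrow> P w) \<Longrightarrow> P v"
  shows "P v"
  using assms(1)
proof (induction v rule: wf_induct_rule[OF wf_succs[OF cascade]])
  case (1 v)
  show ?case
  proof (cases "v \<in> max_nodes V")
    case False
    show ?thesis
    proof (rule assms(3))
      show "v \<in> nodes V - max_nodes V" using 1 False by simp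
      show "P w" if "w \<in> succs V v" for w
        using 1 that succsD(1)[OF that] by simp
    qed
  qed (rule assms(2))
qed

text \<open>Two different branching nodes below both leaves are comparable, and the lower one
  branches to the same child for both leaves.\<close>

lemma less_lex_child_iff:
  assumes v: "v \<in> nodes V - max_nodes V" and xy: "x \<in> max_nodes V" "y \<in> max_nodes V"
    and le: "le_node V (child V v n) x" "le_node V (child V v m) y" and "n \<noteq> m"
  shows "less_lex V x y \<longleftrightarrow> n < m"
proof
  show "less_lex V x y" if "n < m"
    unfolding less_lex_def using that assms by blast
next
  assume "less_lex V x y"
  moreover have xyn: "x \<in> nodes V" "y \<in> nodes V" using xy max_nodesD by auto
  moreover have "\<not> less_node V y x"
    using xy(2) xyn by (auto simp: max_nodes_def)
  ultimately obtain v' n' m' where v': "v' \<in> nodes V - max_nodes V" "n' < m'"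
    "le_node V (child V v' n') x" "le_node V (child V v' m') y"
    unfolding less_lex_def by blast
  have below: "le_node V w z"
    if "w \<in> nodes V - max_nodes V" "le_node V (child V w k) z" "z \<in> nodes V" for w k z
    using le_trans[of w "child V w k" z] that succsD[OF child_succs[OF that(1)]] by auto
  have no: False
    if w: "w \<in> nodes V - max_nodes V" "w' \<in> nodes V" "le_node V w w'" "w \<noteq> w'"
      "le_node V w' x" "le_node V w' y" "le_node V (child V w k) x" "le_node V (child V w l) y" "k \<noteq> l"
    for w w' k l
  proof -
    obtain z where z: "z \<in> succs V w" "le_node V z w'" using ex_succs_below w by blast
    have "z \<in> nodes V" using z succsD by blast
    then have "le_node V z x" "le_node V z y" using z le_trans w xyn by blast+
    then have "child V w k = z" "child V w l = z"
      using succs_unique_below[OF child_succs z(1)] w xyn by blast+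
    then have "k = l"
      using child_bij[OF w(1)] by (auto simp: bij_betw_def inj_on_def)
    with w show False by simp
  qed
  have bv: "le_node V v x" "le_node V v y" "le_node V v' x" "le_node V v' y"
    using below v v' le xyn by blast+
  have "v = v'"
  proof (rule ccontr)
    assume ne: "v \<noteq> v'"
    have "le_node V v v' \<or> le_node V v' v"
      using comparable[of v x v'] bv v v' xyn by blast
    then show False
    proof
      assume "le_node V v v'"
      from no[OF v _ this ne bv(3,4) le \<open>n \<noteq> m\<close>] v' show False by blast
    next
      assume "le_node V v' v"
      from no[OF v'(1) _ this _ bv(1,2) v'(3,4)] v v'(2) ne show False by blast
    qed
  qed
  then have "n' = n" "m' = m" using child_unique v' le v xyn by blast+
  with v'(2) show "n < m" by simp
qed

text \<open>Justifies the choice in \<open>lex_embedding\<close>. By induction from the leaves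
  towards the root, the embeddings belonging to the children of \<open>v\<close> are stacked one
  after the other; countability of the set of leaves leaves room in \<open>omega1\<close> for every
  further block.\<close>

lemma ex_lex_embedding:
  assumes "v \<in> nodes V"
  shows "\<exists>f :: nat + 'a \<Rightarrow> omega1. \<forall>x\<in>max_nodes V. \<forall>y\<in>max_nodes V.
    le_node V v x \<longrightarrow> le_node V v y \<longrightarrow> (less_lex V x y \<longleftrightarrow> f x < f y)"
  using assms
proof (induction v rule: node_induct)
  case (max v)
  have "\<not> less_lex V v v"
    using child_unique max_nodesD[OF max] unfolding less_lex_def less_node_def by blast
  moreover have "x = v" if "x \<in> max_nodes V" "le_node V v x" for x
    using le_max[OF max max_nodesD] that by blast
  ultimately show ?case by (metis less_irrefl)
next
  case (not_max v)
  have "\<forall>n. \<exists>f :: nat + 'a \<Rightarrow> omega1. \<forall>x\<in>max_nodes V. \<forall>y\<in>max_nodes V.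
      le_node V (child V v n) x \<longrightarrow> le_node V (child V v n) y \<longrightarrow> (less_lex V x y \<longleftrightarrow> f x < f y)"
    using not_max(2)[OF child_succs[OF not_max(1)]] by blast
  from choice[OF this] obtain f :: "nat \<Rightarrow> nat + 'a \<Rightarrow> omega1"
    where f: "\<And>n x y. x \<in> max_nodes V \<Longrightarrow> y \<in> max_nodes V \<Longrightarrow>
      le_node V (child V v n) x \<Longrightarrow> le_node V (child V v n) y \<Longrightarrow> (less_lex V x y \<longleftrightarrow> f n x < f n y)"
    by metis
  have cM: "countable (max_nodes V)"
    using max_Inl countable_subset[of "max_nodes V" "range Inl"] by simp
  \<comment> \<open>\<open>base n\<close> is where the block of the \<open>n\<close>-th child
    starts: above every value used for earlier children. Adding it on the left preserves the order
    inside the block.\<close>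
  define base where "base = rec_nat 0 (\<lambda>n b. SOME c. \<forall>a\<in>(\<lambda>x. b + f n x) ` max_nodes V \<union> {b}. a < c)"
  have base: "\<forall>a\<in>(\<lambda>x. base n + f n x) ` max_nodes V \<union> {base n}. a < base (Suc n)" for n
  proof -
    have "countable ((\<lambda>x. base n + f n x) ` max_nodes V \<union> {base n})" using cM by simp
    from someI_ex[OF countable_bounded_omega1[OF this]] show ?thesis by (simp add: base_def)
  qed
  have base_mono: "mono base"
    using base by (intro incseq_SucI) (auto simp: less_imp_le)
  define idx where "idx = (\<lambda>x. THE n. le_node V (child V v n) x)"
  have idx: "idx x = n" if "x \<in> max_nodes V" "le_node V (child V v n) x" for x n
    unfolding idx_def using that child_unique[OF not_max(1)] max_nodesD by blast
  have lt: "base n + f n x < base m + f m y" if "n < m" "x \<in> max_nodes V" for n m x y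
  proof -
    have "base n + f n x < base (Suc n)" using base that by blast
    also have "\<dots> \<le> base m" using base_mono that by (simp add: monoD Suc_leI)
    also have "\<dots> \<le> base m + f m y" by (rule plus_omega1_ge)
    finally show ?thesis .
  qed
  have "less_lex V x y \<longleftrightarrow> base (idx x) + f (idx x) x < base (idx y) + f (idx y) y"
    if xy: "x \<in> max_nodes V" "y \<in> max_nodes V" "le_node V v x" "le_node V v y" for x y
  proof -
    obtain n m where nm: "le_node V (child V v n) x" "le_node V (child V v m) y"
      using ex_child_below[OF not_max(1)] xy by metis
    show ?thesis
    proof (cases "n = m")
      case True
      then show ?thesis using idx xy nm f by auto
    next
      case False
      then show ?thesis
        using idx xy nm less_lex_child_iff[OF not_max(1) xy(1,2) nm False] lt[of n m x y] lt[of m n y x]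
        by (metis less_asym linorder_neqE_nat)
    qed
  qed
  then show ?case by (intro exI[of _ "\<lambda>x. base (idx x) + f (idx x) x"]) blast
qed

lemma lex_embedding:
  assumes "x \<in> max_nodes V" "y \<in> max_nodes V"
  shows "less_lex V x y \<longleftrightarrow> lex_embedding V x < lex_embedding V y"
proof -
  have "\<exists>f :: nat + 'a \<Rightarrow> omega1. \<forall>x\<in>max_nodes V. \<forall>y\<in>max_nodes V. less_lex V x y \<longleftrightarrow> f x < f y"
    using ex_lex_embedding[OF root(1)] root(2) max_nodesD by metis
  from someI_ex[OF this] show ?thesis
    unfolding lex_embedding_def using assms by blast
qed

end

section \<open>Branching degree and order type\<close>

definition up :: "(nat + 'a) cascade \<Rightarrow> nat + 'a \<Rightarrow> nat set" where
  "up V v = {x. le_node V v (Inl x)}"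

text \<open>For a set \<open>U\<close> of leaves, \<open>branching V k U\<close> turns out to mean that the lexicographic order
  type of \<open>U\<close> is at least \<open>\<omega> ^ k\<close>, although the enumerations of the successors do not occur in it.\<close>

primrec branching :: "(nat + 'a) cascade \<Rightarrow> nat \<Rightarrow> nat set \<Rightarrow> bool" where
  "branching V 0 U \<longleftrightarrow> U \<noteq> {}"
| "branching V (Suc k) U \<longleftrightarrow>
     (\<exists>v\<in>nodes V - max_nodes V. infinite {w \<in> succs V v. branching V k (U \<inter> up V w)})"

lemma branching_mono: "branching V k U \<Longrightarrow> U \<subseteq> U' \<Longrightarrow> branching V k U'"
proof (induction k arbitrary: U U')
  case (Suc k)
  then obtain v where v: "v \<in> nodes V - max_nodes V"
    "infinite {w \<in> succs V v. branching V k (U \<inter> up V w)}" by auto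
  have "{w \<in> succs V v. branching V k (U \<inter> up V w)} \<subseteq> {w \<in> succs V v. branching V k (U' \<inter> up V w)}"
    using Suc.IH Suc.prems(2) by (smt (verit) Collect_mono Int_mono subset_refl)
  with v show ?case by (auto dest: infinite_super)
qed auto

text \<open>Of infinitely many successors, infinitely many favour the same part. So the sets without
  \<open>k\<close>-fold branching form an ideal, the counterpart of the indecomposability of
  \<omega>^k.\<close>

lemma branching_Un: "branching V k (A \<union> B) \<Longrightarrow> branching V k A \<or> branching V k B"
proof (induction k arbitrary: A B)
  case (Suc k)
  then obtain v where v: "v \<in> nodes V - max_nodes V"
    "infinite {w \<in> succs V v. branching V k ((A \<union> B) \<inter> up V w)}" by auto
  have "{w \<in> succs V v. branching V k ((A \<union> B) \<inter> up V w)} \<subseteq>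
      {w \<in> succs V v. branching V k (A \<inter> up V w)} \<union> {w \<in> succs V v. branching V k (B \<inter> up V w)}"
    using Suc.IH by (auto simp: Int_Un_distrib2)
  with v(2) have "infinite {w \<in> succs V v. branching V k (A \<inter> up V w)} \<or>
      infinite {w \<in> succs V v. branching V k (B \<inter> up V w)}"
    by (meson finite_Un finite_subset)
  with v(1) show ?case by auto
qed auto

lemma branching_empty: "\<not> branching V k {}"
  by (induction k) auto

lemma branching_UN:
  "finite I \<Longrightarrow> branching V k (\<Union>i\<in>I. A i) \<Longrightarrow> \<exists>i\<in>I. branching V k (A i)"
  by (induction I rule: finite_induct) (auto simp: branching_empty dest: branching_Un)

context sequential_cascade
begin

abbreviation lex_ot :: "nat set \<Rightarrow> omega1" where
  "lex_ot U \<equiv> ot (lex_embedding V ` Inl ` U)"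

lemma lex_ot_mono: "U \<subseteq> U' \<Longrightarrow> lex_ot U \<le> lex_ot U'"
  by (rule ot_mono) auto

lemma lex_embedding_less_child:
  assumes "v \<in> nodes V - max_nodes V" "x \<in> leaves V" "y \<in> leaves V"
    "x \<in> up V (child V v n)" "y \<in> up V (child V v m)" "n < m"
  shows "lex_embedding V (Inl x) < lex_embedding V (Inl y)"
proof -
  have "less_lex V (Inl x) (Inl y)"
    using assms unfolding less_lex_def up_def by blast
  then show ?thesis using assms lex_embedding by (auto simp: leaves_def)
qed

lemma lex_ot_Un:
  assumes "v \<in> nodes V - max_nodes V" "X \<subseteq> leaves V" "Y \<subseteq> leaves V"
    "\<And>x. x \<in> X \<Longrightarrow> \<exists>n<i. x \<in> up V (child V v n)" "\<And>y. y \<in> Y \<Longrightarrow> \<exists>n\<ge>i. y \<in> up V (child V v n)"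
  shows "lex_ot (X \<union> Y) = lex_ot X + lex_ot Y"
  unfolding image_Un
proof (rule ot_Un)
  fix a b assume "a \<in> lex_embedding V ` Inl ` X" "b \<in> lex_embedding V ` Inl ` Y"
  then obtain x y where xy: "x \<in> X" "y \<in> Y" "a = lex_embedding V (Inl x)" "b = lex_embedding V (Inl y)"
    by blast
  obtain n m where "n < i" "x \<in> up V (child V v n)" "m \<ge> i" "y \<in> up V (child V v m)"
    using assms(4,5) xy by blast
  then show "a < b" using lex_embedding_less_child[of v x y n m] assms xy by auto
qed auto

text \<open>Infinitely many children of the witness carry a block of type at least \<omega>^k each,
  and the blocks follow each other in the order of the children. Hence every finite multiple of
  \<omega>^k is reached.\<close>

lemma omega_power_le_lex_ot:
  "branching V k U \<Longrightarrow> U \<subseteq> leaves V \<Longrightarrow> omega_power k \<le> lex_ot U"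
proof (induction k arbitrary: U)
  case 0
  then have "0 < lex_ot U" by (intro ot_pos) auto
  then show ?case using ord_of_nat_Suc_le[of 0] by (simp add: omega_power.simps)
next
  case (Suc k)
  note IH = Suc.IH
  obtain v where v: "v \<in> nodes V - max_nodes V"
    "infinite {w \<in> succs V v. branching V k (U \<inter> up V w)}" using Suc.prems by auto
  define N where "N = {n. branching V k (U \<inter> up V (child V v n))}"
  have "{w \<in> succs V v. branching V k (U \<inter> up V w)} \<subseteq> child V v ` N"
    using child_bij[OF v(1)] by (auto simp: N_def bij_betw_def)
  then have N: "infinite N" using v(2) finite_surj by blast
  define B where "B = (\<lambda>i. U \<inter> (\<Union>n<i. up V (child V v n)))"
  have "\<exists>i. times_nat_omega1 (omega_power k) m \<le> lex_ot (B i)" for m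
  proof (induction m)
    case (Suc m)
    then obtain i where i: "times_nat_omega1 (omega_power k) m \<le> lex_ot (B i)" by blast
    obtain n where n: "n \<in> N" "n \<ge> i" using N by (meson infinite_nat_iff_unbounded_le)
    let ?X = "U \<inter> up V (child V v n)"
    have "omega_power k \<le> lex_ot ?X"
      using n \<open>U \<subseteq> leaves V\<close> by (intro IH) (auto simp: N_def)
    with i have "times_nat_omega1 (omega_power k) (Suc m) \<le> lex_ot (B i) + lex_ot ?X"
      by (simp add: plus_omega1_mono)
    also have "\<dots> = lex_ot (B i \<union> ?X)"
      using \<open>U \<subseteq> leaves V\<close> n by (intro lex_ot_Un[OF v(1), of _ _ i, symmetric]) (auto simp: B_def)
    also have "\<dots> \<le> lex_ot (B (Suc n))"
      using n by (intro lex_ot_mono) (auto simp: B_def intro: less_SucI less_le_trans)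
    finally show ?case by blast
  qed auto
  moreover have "lex_ot (B i) \<le> lex_ot U" for i by (rule lex_ot_mono) (auto simp: B_def)
  ultimately show ?case by (intro omega_power_Suc_le) (meson order_trans)
qed

text \<open>Indecomposability of \<omega>^k, applied to one block after the other.\<close>

lemma lex_ot_UN_less:
  assumes v: "v \<in> nodes V - max_nodes V" and U: "U \<subseteq> leaves V" and "j \<le> i"
    and less: "\<And>n. j \<le> n \<Longrightarrow> n < i \<Longrightarrow> lex_ot (U \<inter> up V (child V v n)) < omega_power k"
  shows "lex_ot (U \<inter> (\<Union>n\<in>{j..<i}. up V (child V v n))) < omega_power k"
  using \<open>j \<le> i\<close> less
proof (induction i rule: dec_induct)
  case base
  then show ?case by (simp add: omega_power_pos)
next
  case (step i)
  let ?X = "U \<inter> (\<Union>n\<in>{j..<i}. up V (child V v n))" and ?Y = "U \<inter> up V (child V v i)"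
  have "lex_ot (?X \<union> ?Y) = lex_ot ?X + lex_ot ?Y"
    using U by (intro lex_ot_Un[OF v, of _ _ i]) auto
  also have "\<dots> < omega_power k"
    using step indecomposable_omega_power[of k] by (auto simp: indecomposable_def)
  finally show ?case using step(1) by (simp add: atLeastLessThanSuc Int_Un_distrib Un_commute)
qed

lemma up_not_max:
  assumes "v \<in> nodes V - max_nodes V" "x \<in> leaves V"
  shows "x \<in> up V v \<longleftrightarrow> (\<exists>n. x \<in> up V (child V v n))"
proof
  assume "x \<in> up V v"
  then show "\<exists>n. x \<in> up V (child V v n)"
    using ex_child_below[of v "Inl x"] assms by (auto simp: up_def leaves_def)
next
  assume "\<exists>n. x \<in> up V (child V v n)"
  then show "x \<in> up V v"
    using assms le_trans[of v "child V v _" "Inl x"] succsD[OF child_succs[OF assms(1)]]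
    by (auto simp: up_def leaves_def max_nodes_def)
qed

text \<open>Converse of \<open>omega_power_le_lex_ot\<close>, by induction from the leaves for all
  \<open>k\<close> at once. For \<open>k = Suc j\<close> only finitely many children of
  \<open>v\<close> carry \<open>j\<close>-fold branching; they lie among the first \<open>i\<close>
  children, and the tail behind them has type at most \<omega>^j.\<close>

lemma lex_ot_less_omega_power:
  assumes "v \<in> nodes V" "U \<subseteq> leaves V" "\<not> branching V k (U \<inter> up V v)"
  shows "lex_ot (U \<inter> up V v) < omega_power k"
  using assms(1,3)
proof (induction v arbitrary: k rule: node_induct)
  case (max v)
  show ?case
  proof (cases k)
    case 0
    with max show ?thesis by (simp add: omega_power_pos)
  next
    case (Suc j)
    have "x = v" if "x \<in> Inl ` (U \<inter> up V v)" for x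
      using that le_max[OF max(1)] assms(2) by (auto simp: up_def leaves_def max_nodes_def)
    then have "Inl ` (U \<inter> up V v) \<subseteq> {v}" by blast
    then have "lex_ot (U \<inter> up V v) \<le> ot {lex_embedding V v}"
      by (intro ot_mono) auto
    also have "\<dots> \<le> omega_power 0"
      by (rule ot_leI) (auto simp: omega_power_pos)
    also have "\<dots> < omega_power k"
      using Suc strict_mono_less[OF strict_mono_omega_power, of 0 k] by simp
    finally show ?thesis .
  qed
next
  case (not_max v)
  show ?case
  proof (cases k)
    case 0
    with not_max show ?thesis by (simp add: omega_power_pos)
  next
    case (Suc j)
    let ?b = "\<lambda>n. up V (child V v n)"
    have b: "U \<inter> up V v \<inter> ?b n = U \<inter> ?b n" for n
      using up_not_max[OF not_max(1)] assms(2) by blast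
    define N where "N = {n. branching V j (U \<inter> ?b n)}"
    have "child V v ` N \<subseteq> {w \<in> succs V v. branching V j (U \<inter> up V v \<inter> up V w)}"
      using child_succs[OF not_max(1)] by (auto simp: N_def b)
    moreover have "finite {w \<in> succs V v. branching V j (U \<inter> up V v \<inter> up V w)}"
      using not_max Suc by auto
    ultimately have "finite (child V v ` N)" by (rule finite_subset)
    then have "finite N"
      using child_bij[OF not_max(1)] by (auto simp: bij_betw_def intro: finite_imageD inj_on_subset)
    then obtain i where i: "N \<subseteq> {..<i}" unfolding finite_nat_iff_bounded by blast
    have small: "lex_ot (U \<inter> ?b n) < omega_power j" if "n \<ge> i" for n
    proof -
      have "n \<notin> N" using i that by auto
      then show ?thesis using not_max(2)[OF child_succs[OF not_max(1)]] by (simp add: N_def)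
    qed
    define X where "X = U \<inter> (\<Union>n\<in>{0..<i}. ?b n)"
    define Y where "Y = U \<inter> (\<Union>n\<in>{i..}. ?b n)"
    have "U \<inter> up V v = U \<inter> (\<Union>n. ?b n)"
      using up_not_max[OF not_max(1)] assms(2) by blast
    also have "(\<Union>n. ?b n) = (\<Union>n\<in>{0..<i} \<union> {i..}. ?b n)"
      by (simp add: ivl_disj_un)
    finally have XY: "U \<inter> up V v = X \<union> Y" by (auto simp: X_def Y_def)
    \<comment> \<open>Here the induction hypothesis is used at \<open>k\<close> itself, since these
      finitely many children may well have \<open>j\<close>-fold branching.\<close>
    have lessX: "lex_ot X < omega_power k"
      unfolding X_def
    proof (rule lex_ot_UN_less[OF not_max(1) assms(2)])
      fix n
      have "\<not> branching V k (U \<inter> ?b n)"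
        using not_max(3) branching_mono[of V k "U \<inter> ?b n"] b by blast
      then show "lex_ot (U \<inter> ?b n) < omega_power k"
        using not_max(2)[OF child_succs[OF not_max(1)]] by blast
    qed simp
    \<comment> \<open>In the tail the hypothesis applies at \<open>j\<close>. A proper initial
      segment of \<open>Y\<close> meets only finitely many blocks, so its type is below \<omega>^j;
      the whole of \<open>Y\<close> can at most reach \<omega>^j.\<close>
    have leY: "lex_ot Y \<le> omega_power j"
    proof (rule ot_leI)
      fix a assume "a \<in> lex_embedding V ` Inl ` Y"
      then obtain y n where y: "y \<in> Y" "a = lex_embedding V (Inl y)" "n \<ge> i" "y \<in> ?b n"
        by (auto simp: Y_def)
      have "lex_embedding V ` Inl ` Y \<inter> {..<a} \<subseteq>
          lex_embedding V ` Inl ` (U \<inter> (\<Union>n\<in>{i..<Suc n}. ?b n))"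
      proof
        fix c assume c: "c \<in> lex_embedding V ` Inl ` Y \<inter> {..<a}"
        then obtain z m where z: "z \<in> Y" "c = lex_embedding V (Inl z)" "m \<ge> i" "z \<in> ?b m"
          by (auto simp: Y_def)
        have leaf: "y \<in> leaves V" "z \<in> leaves V" using y(1) z(1) assms(2) by (auto simp: Y_def)
        have "c < a" using c by simp
        then have "\<not> n < m"
          using lex_embedding_less_child[OF not_max(1) leaf y(4) z(4)] y(2) z(2) by auto
        then have "z \<in> U \<inter> (\<Union>n\<in>{i..<Suc n}. ?b n)"
          using z(1,3,4) by (auto simp: Y_def)
        then show "c \<in> lex_embedding V ` Inl ` (U \<inter> (\<Union>n\<in>{i..<Suc n}. ?b n))"
          using z(2) by blast
      qed
      then have "ot (lex_embedding V ` Inl ` Y \<inter> {..<a}) \<le> lex_ot (U \<inter> (\<Union>n\<in>{i..<Suc n}. ?b n))"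
        by (intro ot_mono) auto
      also have "\<dots> < omega_power j"
        using y small by (intro lex_ot_UN_less[OF not_max(1) assms(2)]) auto
      finally show "ot (lex_embedding V ` Inl ` Y \<inter> {..<a}) < omega_power j" .
    qed auto
    have "lex_ot (U \<inter> up V v) = lex_ot X + lex_ot Y"
      unfolding XY using assms(2) by (intro lex_ot_Un[OF not_max(1), of _ _ i]) (auto simp: X_def Y_def)
    moreover have "lex_ot Y < omega_power k"
      using leY omega_power_less_Suc[of j] Suc by (metis le_less_trans)
    ultimately show ?thesis
      using lessX indecomposable_omega_power[of k] unfolding indecomposable_def by presburger
  qed
qed

lemma not_branching_lex_ot_less:
  assumes "U \<subseteq> leaves V" "\<not> branching V k U"
  shows "lex_ot U < omega_power k"
proof -
  have "U \<inter> up V (root_node V) = U"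
    using assms(1) root(2) by (auto simp: up_def leaves_def max_nodes_def)
  then show ?thesis using lex_ot_less_omega_power[OF root(1) assms(1), of k] assms(2) by simp
qed

end

text \<open>Comparing orders becomes comparing branching degrees: \<open>branching\<close> detects
  which powers of \<omega> an order type reaches, and \<open>bounded\<close> keeps the types below
  \<omega>^\<omega>, where \<open>indec\<close> of a nonzero type is such a power.\<close>

lemma increases_orderI:
  assumes "sequential_cascade V" "sequential_cascade W" "leaves W \<subseteq> leaves V"
    and bounded: "\<And>U. U \<subseteq> leaves W \<Longrightarrow> \<exists>k. \<not> branching W k U"
    and branching: "\<And>U k. U \<subseteq> leaves W \<Longrightarrow> branching V k U \<Longrightarrow> branching W k U"
  shows "increases_order W V"
  unfolding increases_order_def
proof (intro conjI allI impI)
  interpret V: sequential_cascade V by fact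
  interpret W: sequential_cascade W by fact
  fix U assume U: "U \<subseteq> leaves W"
  then have UV: "U \<subseteq> leaves V" using assms(3) by blast
  define k where "k = (LEAST k. \<not> branching V k U)"
  have "\<exists>k. \<not> branching V k U" using bounded[OF U] branching[OF U] by blast
  from LeastI_ex[OF this] have k: "\<not> branching V k U" unfolding k_def .
  have "V.lex_ot U = 0 \<or> (\<exists>j<k. indec (V.lex_ot U) = omega_power j)"
    by (rule indec_omega_power_cases[OF V.not_branching_lex_ot_less[OF UV k]])
  then show "indec (V.lex_ot U) \<le> W.lex_ot U"
  proof
    assume "V.lex_ot U = 0"
    then show ?thesis by (simp add: indec_def)
  next
    assume "\<exists>j<k. indec (V.lex_ot U) = omega_power j"
    then obtain j where j: "j < k" "indec (V.lex_ot U) = omega_power j" by blast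
    then have "branching V j U" using not_less_Least[of j] unfolding k_def by blast
    then show ?thesis using W.omega_power_le_lex_ot[OF branching[OF U] U] j by simp
  qed
qed (rule assms(3))

section \<open>Full branches of cascades of finite rank\<close>

text \<open>\<open>anc k x\<close> is the node of level \<open>k\<close> below the leaf
  \<open>x\<close>. All leaves in \<open>A\<close> end branches of the same length \<open>r\<close>;
  shorter branches, which come from successors of too small a rank, are left out.\<close>

locale full_branches = sequential_cascade V for V :: "(nat + 'a) cascade" +
  fixes A :: "nat set" and r :: nat and anc :: "nat \<Rightarrow> nat \<Rightarrow> nat + 'a"
  assumes anc_0: "x \<in> A \<Longrightarrow> anc 0 x = root_node V"
    and anc_not_max: "x \<in> A \<Longrightarrow> k < r \<Longrightarrow> anc k x \<in> nodes V - max_nodes V"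
    and anc_Suc: "x \<in> A \<Longrightarrow> k < r \<Longrightarrow> anc (Suc k) x \<in> succs V (anc k x)"
    and anc_top: "x \<in> A \<Longrightarrow> anc r x = Inl x"
    and A_leaves: "A \<subseteq> leaves V"
begin

lemma anc_node: "x \<in> A \<Longrightarrow> k \<le> r \<Longrightarrow> anc k x \<in> nodes V"
  using anc_not_max[of x k] anc_top[of x] A_leaves
  by (cases "k < r") (auto simp: leaves_def max_nodes_def)

lemma anc_mono:
  assumes "x \<in> A" "i \<le> j" "j \<le> r"
  shows "le_node V (anc i x) (anc j x)"
  using assms(2,3)
proof (induction j rule: dec_induct)
  case base
  then show ?case using le_refl anc_node assms(1) by blast
next
  case (step j)
  then show ?case
    using le_trans[of "anc i x" "anc j x" "anc (Suc j) x"] anc_node[of x] succsD(2)[OF anc_Suc[of x j]] assms(1)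
    by simp
qed

text \<open>Passing to parents on both branches simultaneously, the root is met on both at the same
  moment.\<close>

lemma anc_level:
  assumes "x \<in> A" "y \<in> A" "i \<le> r" "j \<le> r" "anc i x = anc j y"
  shows "i = j"
proof -
  have root_Suc: "anc (Suc k) z \<noteq> root_node V" if "z \<in> A" "k < r" for z k
    using le_antisym[of "anc k z" "anc (Suc k) z"] root succsD[OF anc_Suc[OF that]] anc_node[of z k] that
    by (metis less_imp_le)
  show ?thesis
    using assms(3-5)
  proof (induction i arbitrary: j)
    case 0
    show ?case
    proof (cases j)
      case (Suc j')
      with 0 have "anc (Suc j') y = root_node V" "j' < r" using anc_0[OF assms(1)] by auto
      with root_Suc[OF assms(2)] show ?thesis by blast
    qed simp
  next
    case (Suc i)
    show ?case
    proof (cases j)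
      case 0
      with Suc.prems have "anc (Suc i) x = root_node V" "i < r" using anc_0[OF assms(2)] by auto
      with root_Suc[OF assms(1)] show ?thesis by blast
    next
      case (Suc j')
      have "anc i x = anc j' y"
        using succs_parent_unique[of "anc (Suc i) x" "anc i x" "anc j' y"] anc_Suc[of x i] anc_Suc[of y j']
          anc_node[of x i] anc_node[of y j'] assms(1,2) Suc.prems Suc by auto
      then show ?thesis using Suc.IH[of j'] Suc.prems Suc by simp
    qed
  qed
qed

lemma anc_cong:
  assumes "x \<in> A" "y \<in> A" "i \<le> j" "j \<le> r" "anc j x = anc j y"
  shows "anc i x = anc i y"
  using assms(3,4,5)
proof (induction j rule: dec_induct)
  case (step j)
  have "anc j x = anc j y"
  proof (rule succs_parent_unique)
    show "anc (Suc j) x \<in> succs V (anc j x)" "anc (Suc j) x \<in> succs V (anc j y)"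
      using anc_Suc[of x j] anc_Suc[of y j] assms(1,2) step.prems by (simp, metis Suc_le_lessD)
  qed (use anc_node[of _ j] assms(1,2) step.prems in auto)
  then show ?case using step by simp
qed

lemma below_anc:
  assumes "x \<in> A" "w \<in> nodes V" "k \<le> r" "le_node V w (anc k x)"
  shows "\<exists>i\<le>k. w = anc i x"
  using assms(3,4)
proof (induction k)
  case 0
  then show ?case using le_antisym[of w "root_node V"] root assms anc_0 by auto
next
  case (Suc k)
  have n: "anc k x \<in> nodes V" "anc (Suc k) x \<in> nodes V" using anc_node assms(1) Suc.prems by auto
  have s: "anc (Suc k) x \<in> succs V (anc k x)" using anc_Suc assms(1) Suc.prems by auto
  show ?case
  proof (cases "le_node V w (anc k x)")
    case True
    then show ?thesis using Suc by (meson Suc_leD le_SucI)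
  next
    case False
    then have "le_node V (anc k x) w"
      using comparable[of w "anc (Suc k) x" "anc k x"] assms(2) n succsD(2)[OF s] Suc.prems by blast
    then have "w = anc k x \<or> w = anc (Suc k) x"
      using succsD(4)[OF s] assms(2) Suc.prems by blast
    then show ?thesis by (metis le_SucI order_refl)
  qed
qed

text \<open>A natural number naming the node \<open>anc k x\<close>, as the comparison of functions
  modulo \<open>u\<close> requires numerical values. Choosing the least leaf makes the top code the
  identity on \<open>A\<close>.\<close>

definition code :: "nat \<Rightarrow> nat \<Rightarrow> nat" where
  "code k x = (LEAST y. y \<in> A \<and> anc k y = anc k x)"

lemma code: "x \<in> A \<Longrightarrow> code k x \<in> A" "x \<in> A \<Longrightarrow> anc k (code k x) = anc k x"
proof -
  assume "x \<in> A"
  then have "code k x \<in> A \<and> anc k (code k x) = anc k x"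
    unfolding code_def using LeastI[of "\<lambda>y. y \<in> A \<and> anc k y = anc k x" x] by simp
  then show "code k x \<in> A" "anc k (code k x) = anc k x" by auto
qed

lemma code_eq_iff: "x \<in> A \<Longrightarrow> y \<in> A \<Longrightarrow> code k x = code k y \<longleftrightarrow> anc k x = anc k y"
proof
  assume xy: "x \<in> A" "y \<in> A"
  show "anc k x = anc k y" if "code k x = code k y"
    using code(2)[OF xy(1), of k] code(2)[OF xy(2), of k] that by simp
  show "code k x = code k y" if "anc k x = anc k y"
    unfolding code_def that ..
qed

lemma code_cong: "x \<in> A \<Longrightarrow> y \<in> A \<Longrightarrow> i \<le> j \<Longrightarrow> j \<le> r \<Longrightarrow> code j x = code j y \<Longrightarrow> code i x = code i y"
  using anc_cong[of x y i j] by (simp add: code_eq_iff)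

lemma code_0: "x \<in> A \<Longrightarrow> y \<in> A \<Longrightarrow> code 0 x = code 0 y"
  by (simp add: code_eq_iff anc_0)

lemma code_top: "x \<in> A \<Longrightarrow> code r x = x"
  using code[of x r] anc_top[of x] anc_top[of "code r x"] by simp

text \<open>Distinct nodes of level \<open>Suc k\<close> have distinct codes, so only finitely many
  successors of a node of level \<open>k\<close> have a code below a bound depending on that node.
  Discarding them, with all that lies above them, leaves an open neighbourhood of the root.\<close>

lemma code_Suc_unbounded:
  assumes "k < r" "eventually (\<lambda>x. x \<in> A) (contour V)"
  shows "eventually (\<lambda>x. f (code k x) < code (Suc k) x) (contour V)"
proof -
  define S where "S = {v \<in> nodes V. \<forall>x\<in>A. le_node V (anc (Suc k) x) v \<longrightarrow> f (code k x) < code (Suc k) x}"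
  have "openin (cascade_topology V) S"
    unfolding openin_cascade_topology
  proof (intro conjI ballI)
    fix v assume v: "v \<in> S - max_nodes V"
    \<comment> \<open>This is the code of \<open>v\<close> when \<open>v\<close> has level
      \<open>k\<close>. At nodes of other levels no successor is lost, because a lost one turns out
      to have a parent of level \<open>k\<close>.\<close>
    define M where "M = (LEAST y. y \<in> A \<and> anc k y = v)"
    have "succs V v - S \<subseteq> anc (Suc k) ` {..f M}"
    proof
      fix w assume w: "w \<in> succs V v - S"
      then have wn: "w \<in> nodes V" using succsD by blast
      with w obtain x where x: "x \<in> A" "le_node V (anc (Suc k) x) w" "code (Suc k) x \<le> f (code k x)"
        by (auto simp: S_def not_less)
      let ?a = "anc (Suc k) x"
      have an: "?a \<in> nodes V" using anc_node x assms(1) by simp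
      have "\<not> le_node V ?a v" using v x by (auto simp: S_def not_less[symmetric])
      then have "le_node V v ?a"
        using comparable[of ?a w v] x an wn v w succsD(2) by (auto simp: S_def)
      then have aw: "?a = w"
        using succsD(4)[of w v ?a] w an x \<open>\<not> le_node V ?a v\<close> v le_refl by (auto simp: S_def)
      then have "anc k x = v"
        using succs_parent_unique[of w "anc k x" v] anc_Suc[OF x(1) assms(1)] anc_node[of x k] w v x assms(1)
        by (auto simp: S_def)
      then have "code k x = M" by (simp add: M_def code_def)
      then show "w \<in> anc (Suc k) ` {..f M}"
        using x aw code[OF x(1), of "Suc k"] by (metis atMost_iff image_eqI)
    qed
    then show "finite (succs V v - S)" using finite_surj by blast
  qed (auto simp: S_def)
  moreover have "root_node V \<in> S"
  proof -
    have "\<not> le_node V (anc (Suc k) x) (root_node V)" if "x \<in> A" for x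
      using that assms(1) anc_level[of x x "Suc k" 0] anc_0[of x] le_antisym[of _ "root_node V"] root
        anc_node[of x "Suc k"] by auto
    then show ?thesis using root by (auto simp: S_def)
  qed
  ultimately have "eventually (\<lambda>x. Inl x \<in> S) (contour V)"
    unfolding eventually_contour[OF root(1)] by blast
  with assms(2) show ?thesis
  proof eventually_elim
    case (elim x)
    then show ?case using anc_mono[of x "Suc k" r] assms(1) by (auto simp: S_def anc_top)
  qed
qed

end

section \<open>Ranks of successors and existence of full branches\<close>

context sequential_cascade
begin

lemma rank_less:
  assumes "v \<in> nodes V - max_nodes V" "w \<in> succs V v"
  shows "rank_node V w < rank_node V v"
proof -
  have "countable (rank_node V ` succs V v)"
    using mono_seq assms(1) by (auto simp: monotone_sequential_def sequential_def)
  from countable_bounded_omega1[OF this] have "\<exists>a. \<forall>w\<in>succs V v. rank_node V w < a" by auto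
  from LeastI_ex[OF this] show ?thesis
    using assms rank_node_not_max[OF cascade assms(1)] by simp
qed

text \<open>Some successor must have rank \<open>j\<close>, as otherwise the rank of
  \<open>v\<close> would be at most \<open>j\<close>. Monotonicity of the enumeration then keeps all
  later successors at that rank.\<close>

lemma finite_succs_rank:
  assumes "v \<in> nodes V - max_nodes V" "rank_node V v = ord_of_nat (Suc j)"
  shows "finite {w \<in> succs V v. rank_node V w \<noteq> ord_of_nat j}"
proof -
  have le: "rank_node V w \<le> ord_of_nat j" if "w \<in> succs V v" for w
    using rank_less[OF assms(1) that] assms(2) by (simp add: less_ord_of_nat_Suc)
  have "\<exists>w\<in>succs V v. \<not> rank_node V w < ord_of_nat j"
  proof (rule ccontr)
    assume "\<not> ?thesis"
    then have "rank_node V v \<le> ord_of_nat j"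
      unfolding rank_node_not_max[OF cascade assms(1)] by (intro Least_le) blast
    then show False using assms(2) ord_of_nat_less_Suc[of j] by simp
  qed
  then obtain n where n: "\<not> rank_node V (child V v n) < ord_of_nat j"
    using child_bij[OF assms(1)] by (metis bij_betw_imp_surj_on imageE)
  have "mono (\<lambda>n. rank_node V (child V v n))"
    using mono_seq assms(1) by (simp add: monotone_sequential_def)
  then have eq: "rank_node V (child V v m) = ord_of_nat j" if "m \<ge> n" for m
    using n le[OF child_succs[OF assms(1), of m]] that by (auto simp: not_less mono_def intro: antisym order_trans)
  have "{w \<in> succs V v. rank_node V w \<noteq> ord_of_nat j} \<subseteq> child V v ` {..<n}"
  proof safe
    fix w assume w: "w \<in> succs V v" "rank_node V w \<noteq> ord_of_nat j"
    then obtain m where "w = child V v m"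
      using child_bij[OF assms(1)] by (metis bij_betw_imp_surj_on imageE)
    with w eq[of m] show "w \<in> child V v ` {..<n}" by (cases "m < n") auto
  qed
  then show ?thesis using finite_surj by blast
qed

lemma ex_full_branches:
  assumes "cascade_rank V = ord_of_nat r"
  shows "\<exists>A anc. full_branches V A r anc \<and> eventually (\<lambda>x. x \<in> A) (contour V)"
proof -
  define path where "path = (\<lambda>k f. f 0 = root_node V \<and>
    (\<forall>j<k. f j \<in> nodes V - max_nodes V \<and> f (Suc j) \<in> succs V (f j)))"
  define A where "A = {x \<in> leaves V. \<exists>f. path r f \<and> f r = Inl x}"
  have "\<forall>x\<in>A. \<exists>f. path r f \<and> f r = Inl x" by (auto simp: A_def)
  from bchoice[OF this] obtain F where F: "\<And>x. x \<in> A \<Longrightarrow> path r (F x) \<and> F x r = Inl x" by blast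
  have fb: "full_branches V A r (\<lambda>k x. F x k)"
    by unfold_locales (use F in \<open>auto simp: path_def A_def\<close>)
  \<comment> \<open>Nodes along which the rank has dropped by exactly one at each level. Each such
    node loses only finitely many successors, and a leaf in \<open>S\<close> has rank 0, hence level
    \<open>r\<close>.\<close>
  define S where "S = {v \<in> nodes V. \<exists>k f. k \<le> r \<and> path k f \<and> f k = v \<and> rank_node V v = ord_of_nat (r - k)}"
  have "openin (cascade_topology V) S"
    unfolding openin_cascade_topology
  proof (intro conjI ballI)
    fix v assume v: "v \<in> S - max_nodes V"
    then obtain k f where kf: "k \<le> r" "path k f" "f k = v" "rank_node V v = ord_of_nat (r - k)"
      by (auto simp: S_def)
    have vn: "v \<in> nodes V - max_nodes V" using v by (auto simp: S_def)
    have "r - k \<noteq> 0"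
      using kf(4) rank_less[OF vn child_succs[OF vn, of 0]] by auto
    then obtain j where j: "r - k = Suc j" using not0_implies_Suc by blast
    have "w \<in> S" if w: "w \<in> succs V v" "rank_node V w = ord_of_nat j" for w
    proof -
      have "path (Suc k) (f(Suc k := w))"
        using kf vn w by (auto simp: path_def less_Suc_eq)
      moreover have "r - Suc k = j" "Suc k \<le> r" using j by auto
      ultimately show ?thesis
        using w succsD(1)[OF w(1)] unfolding S_def
        by (auto intro!: exI[of _ "Suc k"] exI[of _ "f(Suc k := w)"])
    qed
    then have "succs V v - S \<subseteq> {w \<in> succs V v. rank_node V w \<noteq> ord_of_nat j}" by blast
    then show "finite (succs V v - S)"
      by (rule finite_subset) (use finite_succs_rank[OF vn] kf(4) j in simp)
  qed (auto simp: S_def)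
  moreover have "root_node V \<in> S"
    using root assms
    by (auto simp: S_def path_def cascade_rank_def intro!: exI[of _ 0] exI[of _ "\<lambda>_. root_node V"])
  moreover have "x \<in> A" if x: "Inl x \<in> S \<inter> max_nodes V" for x
  proof -
    obtain k f where kf: "k \<le> r" "path k f" "f k = Inl x" "rank_node V (Inl x) = ord_of_nat (r - k)"
      using x by (auto simp: S_def)
    have "ord_of_nat (r - k) = ord_of_nat 0"
      using kf(4) rank_node_max[OF cascade, of "Inl x"] x by simp
    then have "r - k = 0" using strict_mono_eq[OF strict_mono_ord_of_nat] by blast
    with kf x show ?thesis by (auto simp: A_def leaves_def)
  qed
  ultimately have "eventually (\<lambda>x. x \<in> A) (contour V)"
    unfolding eventually_contour[OF root(1)] by blast
  with fb show ?thesis by blast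
qed

end

section \<open>Domination modulo an ultrafilter\<close>

lemma ultrafilter_eventually_cases:
  assumes "ultrafilter u"
  shows "eventually P u \<or> eventually (\<lambda>x. \<not> P x) u"
proof (cases "eventually (\<lambda>x. \<not> P x) u")
  case False
  then have "inf u (principal {x. P x}) \<noteq> bot"
    by (simp add: trivial_limit_def eventually_inf_principal)
  moreover have "inf u (principal {x. P x}) \<le> u" by simp
  ultimately have "inf u (principal {x. P x}) = u"
    using assms unfolding ultrafilter_def by blast
  moreover have "eventually P (inf u (principal {x. P x}))"
    by (simp add: eventually_inf_principal)
  ultimately show ?thesis by simp
qed simp

text \<open>In other words, on some set of \<open>u\<close> the function \<open>f\<close> takes only
  finitely many values on each fibre of \<open>g\<close>.\<close>

definition dominated :: "nat filter \<Rightarrow> (nat \<Rightarrow> nat) \<Rightarrow> (nat \<Rightarrow> nat) \<Rightarrow> bool" where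
  "dominated u f g \<longleftrightarrow> (\<exists>h. eventually (\<lambda>x. f x \<le> h (g x)) u)"

lemma dominated_refl: "dominated u f f"
  unfolding dominated_def by (rule exI[of _ id]) simp

lemma dominated_trans:
  assumes "dominated u f g" "dominated u g h"
  shows "dominated u f h"
proof -
  obtain a b where "eventually (\<lambda>x. f x \<le> a (g x)) u" "eventually (\<lambda>x. g x \<le> b (h x)) u"
    using assms unfolding dominated_def by blast
  \<comment> \<open>The bound \<open>a\<close> need not be monotone, so it is replaced by its
    running maximum.\<close>
  then have "eventually (\<lambda>x. f x \<le> Max (a ` {..b (h x)})) u"
    by eventually_elim (rule order_trans, assumption, simp)
  then show ?thesis
    unfolding dominated_def by (intro exI[of _ "\<lambda>z. Max (a ` {..b z})"])
qed

lemma dominated_total: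
  assumes "ultrafilter u"
  shows "dominated u f g \<or> dominated u g f"
proof -
  from ultrafilter_eventually_cases[OF assms, of "\<lambda>x. f x \<le> g x"] show ?thesis
  proof
    assume "eventually (\<lambda>x. f x \<le> g x) u"
    then show ?thesis unfolding dominated_def by (auto intro!: exI[of _ id])
  next
    assume "eventually (\<lambda>x. \<not> f x \<le> g x) u"
    then have "eventually (\<lambda>x. g x \<le> id (f x)) u" by eventually_elim simp
    then show ?thesis unfolding dominated_def by blast
  qed
qed

lemma not_dominatedD:
  assumes "ultrafilter u" "\<not> dominated u f g"
  shows "eventually (\<lambda>x. h (g x) < f x) u"
  using ultrafilter_eventually_cases[OF assms(1), of "\<lambda>x. f x \<le> h (g x)"] assms(2)
  unfolding dominated_def by (auto simp: not_le)

lemma ex_factor: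
  assumes "\<And>x y. x \<in> A \<Longrightarrow> y \<in> A \<Longrightarrow> g x = g y \<Longrightarrow> f x = f y"
  shows "\<exists>h. \<forall>x\<in>A. f x = h (g x)"
proof (intro exI ballI)
  fix x assume "x \<in> A"
  then show "f x = (f \<circ> inv_into A g) (g x)"
    using assms[of x "inv_into A g (g x)"] by (simp add: inv_into_into f_inv_into_f)
qed

lemma dominated_if_determined:
  assumes "eventually (\<lambda>x. x \<in> A) u" "\<And>x y. x \<in> A \<Longrightarrow> y \<in> A \<Longrightarrow> g x = g y \<Longrightarrow> f x = f y"
  shows "dominated u f g"
proof -
  have "\<exists>h. \<forall>x\<in>A. f x = h (g x)" by (rule ex_factor) (rule assms(2))
  then obtain h where "\<And>x. x \<in> A \<Longrightarrow> f x = h (g x)" by blast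
  with assms(1) have "eventually (\<lambda>x. f x \<le> h (g x)) u"
    by (auto elim: eventually_mono)
  then show ?thesis unfolding dominated_def by blast
qed

text \<open>A least upper bound of \<open>f\<close> and \<open>g\<close> in the preorder. The
  pointwise maximum would be one too, but would not determine the values of both functions.\<close>

definition pair :: "(nat \<Rightarrow> nat) \<Rightarrow> (nat \<Rightarrow> nat) \<Rightarrow> nat \<Rightarrow> nat" where
  "pair f g x = prod_encode (f x, g x)"

lemma pair_eq_iff: "pair f g x = pair f g y \<longleftrightarrow> f x = f y \<and> g x = g y"
  by (simp add: pair_def)

lemma dominated_pair:
  assumes "dominated u f h" "dominated u g h"
  shows "dominated u (pair f g) h"
proof -
  obtain a b where "eventually (\<lambda>x. f x \<le> a (h x)) u" "eventually (\<lambda>x. g x \<le> b (h x)) u"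
    using assms unfolding dominated_def by blast
  then have "eventually (\<lambda>x. pair f g x \<le> Max (prod_encode ` ({..a (h x)} \<times> {..b (h x)}))) u"
  proof eventually_elim
    case (elim x)
    then show ?case by (intro Max_ge) (auto simp: pair_def)
  qed
  then show ?thesis
    unfolding dominated_def by (intro exI[of _ "\<lambda>z. Max (prod_encode ` ({..a z} \<times> {..b z}))"])
qed

lemma dominated_pair1: "dominated u f (pair f g)"
  by (rule dominated_if_determined[of UNIV]) (auto simp: pair_eq_iff)

lemma dominated_pair2: "dominated u g (pair f g)"
  by (rule dominated_if_determined[of UNIV]) (auto simp: pair_eq_iff)

text \<open>By totality the pair is equivalent to the larger of \<open>f\<close> and
  \<open>g\<close>.\<close>

lemma not_dominated_pair:
  assumes "ultrafilter u" "\<not> dominated u h f" "\<not> dominated u h g"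
  shows "\<not> dominated u h (pair f g)"
proof
  assume h: "dominated u h (pair f g)"
  from dominated_total[OF assms(1), of f g] show False
  proof
    assume "dominated u f g"
    then have "dominated u (pair f g) g" by (rule dominated_pair) (rule dominated_refl)
    with h assms(3) show False using dominated_trans by blast
  next
    assume "dominated u g f"
    with dominated_refl have "dominated u (pair f g) f" by (rule dominated_pair)
    with h assms(2) show False using dominated_trans by blast
  qed
qed

text \<open>Strictly increasing from the least class of the preorder to the greatest one, so that
  any two such chains start and end together.\<close>

definition growing_chain :: "nat filter \<Rightarrow> nat \<Rightarrow> (nat \<Rightarrow> nat \<Rightarrow> nat) \<Rightarrow> bool" where
  "growing_chain u r c \<longleftrightarrow> (\<forall>f. dominated u (c 0) f) \<and> (\<forall>f. dominated u f (c r)) \<and>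
     (\<forall>k<r. dominated u (c k) (c (Suc k)) \<and> \<not> dominated u (c (Suc k)) (c k))"

text \<open>A step between consecutive levels of the merged chain. Domination by both
  \<open>c (Suc k)\<close> and \<open>d (Suc l)\<close>, even if only one index moves, is what later
  makes successors in \<open>T\<close> finite in number over a fixed next ancestor; non-domination
  by the old pair is what makes \<open>T\<close> branch infinitely.\<close>

definition merge_step ::
  "nat filter \<Rightarrow> nat \<Rightarrow> (nat \<Rightarrow> nat \<Rightarrow> nat) \<Rightarrow> nat \<Rightarrow> (nat \<Rightarrow> nat \<Rightarrow> nat) \<Rightarrow> nat \<times> nat \<Rightarrow> nat \<times> nat \<Rightarrow> bool" where
  "merge_step u r c s d = (\<lambda>(k, l) (k', l').
     k < r \<and> l < s \<and> k' \<in> {k, Suc k} \<and> l' \<in> {l, Suc l} \<and> (k', l') \<noteq> (k, l) \<and>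
     dominated u (pair (c k') (d l')) (c (Suc k)) \<and> dominated u (pair (c k') (d l')) (d (Suc l)) \<and>
     \<not> dominated u (pair (c k') (d l')) (pair (c k) (d l)))"

text \<open>The two last assumptions are the invariant that neither chain lags behind: its next
  entry is not yet dominated by the current entry of the other. The smaller of the two next entries
  is taken, or both if they are equivalent.\<close>

lemma rtranclp_merge_step:
  assumes u: "ultrafilter u" and c: "growing_chain u r c" and d: "growing_chain u s d"
    and "k \<le> r" "l \<le> s"
    and "k < r \<Longrightarrow> \<not> dominated u (c (Suc k)) (d l)" "l < s \<Longrightarrow> \<not> dominated u (d (Suc l)) (c k)"
  shows "(merge_step u r c s d)\<^sup>*\<^sup>* (k, l) (r, s)"
  using assms(4-7)
proof (induction "r - k + (s - l)" arbitrary: k l rule: less_induct)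
  case less
  have top: "dominated u f (c r)" "dominated u f (d s)" for f
    using c d by (auto simp: growing_chain_def)
  have cS: "dominated u (c k) (c (Suc k))" "\<not> dominated u (c (Suc k)) (c k)" if "k < r" for k
    using c that by (auto simp: growing_chain_def)
  have dS: "dominated u (d l) (d (Suc l))" "\<not> dominated u (d (Suc l)) (d l)" if "l < s" for l
    using d that by (auto simp: growing_chain_def)
  \<comment> \<open>A finished chain dominates everything, which by the invariant forces the other
    one to be finished as well.\<close>
  have "k < r \<longleftrightarrow> l < s"
    using less.prems top by (metis le_neq_implies_less)
  show ?case
  proof (cases "k < r")
    case False
    then have "k = r" "l = s" using less.prems \<open>k < r \<longleftrightarrow> l < s\<close> by auto
    then show ?thesis by simp
  next
    case True
    then have kl: "k < r" "l < s" using \<open>k < r \<longleftrightarrow> l < s\<close> by auto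
    note cd = less.prems(3)[OF kl(1)] and dc = less.prems(4)[OF kl(2)]
    have cd': "dominated u (d l) (c (Suc k))" "dominated u (c k) (d (Suc l))"
      using dominated_total[OF u] cd dc by blast+
    have ncp: "\<not> dominated u (c (Suc k)) (pair (c k) (d l))"
      using not_dominated_pair[OF u] cS kl cd by blast
    have ndp: "\<not> dominated u (d (Suc l)) (pair (c k) (d l))"
      using not_dominated_pair[OF u] dS kl dc by blast
    have np: "\<not> dominated u (pair f g) (pair (c k) (d l))"
      if "\<not> dominated u f (pair (c k) (d l)) \<or> \<not> dominated u g (pair (c k) (d l))" for f g
      using that dominated_pair1 dominated_pair2 dominated_trans by blast
    consider (both) "dominated u (c (Suc k)) (d (Suc l))" "dominated u (d (Suc l)) (c (Suc k))"
      | (left) "dominated u (c (Suc k)) (d (Suc l))" "\<not> dominated u (d (Suc l)) (c (Suc k))"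
      | (right) "\<not> dominated u (c (Suc k)) (d (Suc l))" "dominated u (d (Suc l)) (c (Suc k))"
      using dominated_total[OF u] by blast
    then show ?thesis
    proof cases
      case both
      have "merge_step u r c s d (k, l) (Suc k, Suc l)"
        using kl both ncp np by (simp add: merge_step_def dominated_pair dominated_refl)
      moreover have "(merge_step u r c s d)\<^sup>*\<^sup>* (Suc k, Suc l) (r, s)"
      proof (rule less.hyps)
        show "\<not> dominated u (c (Suc (Suc k))) (d (Suc l))" if "Suc k < r"
          using cS(2)[OF that] both(2) dominated_trans by blast
        show "\<not> dominated u (d (Suc (Suc l))) (c (Suc k))" if "Suc l < s"
          using dS(2)[OF that] both(1) dominated_trans by blast
      qed (use kl in auto)
      ultimately show ?thesis by (rule converse_rtranclp_into_rtranclp)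
    next
      case left
      have "merge_step u r c s d (k, l) (Suc k, l)"
        using kl left(1) ncp np cd'(1) dS(1)[OF kl(2)]
        by (simp add: merge_step_def dominated_pair dominated_refl)
      moreover have "(merge_step u r c s d)\<^sup>*\<^sup>* (Suc k, l) (r, s)"
      proof (rule less.hyps)
        show "\<not> dominated u (c (Suc (Suc k))) (d l)" if "Suc k < r"
          using cS(2)[OF that] cd'(1) dominated_trans by blast
        show "\<not> dominated u (d (Suc l)) (c (Suc k))" by (rule left(2))
      qed (use kl in auto)
      ultimately show ?thesis by (rule converse_rtranclp_into_rtranclp)
    next
      case right
      have "merge_step u r c s d (k, l) (k, Suc l)"
        using kl right(2) ndp np cd'(2) cS(1)[OF kl(1)]
        by (simp add: merge_step_def dominated_pair dominated_refl)
      moreover have "(merge_step u r c s d)\<^sup>*\<^sup>* (k, Suc l) (r, s)"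
      proof (rule less.hyps)
        show "\<not> dominated u (c (Suc k)) (d (Suc l))" by (rule right(1))
        show "\<not> dominated u (d (Suc (Suc l))) (c k)" if "Suc l < s"
          using dS(2)[OF that] cd'(2) dominated_trans by blast
      qed (use kl in auto)
      ultimately show ?thesis by (rule converse_rtranclp_into_rtranclp)
    qed
  qed
qed

lemma ex_merge:
  assumes u: "ultrafilter u" and c: "growing_chain u r c" and d: "growing_chain u s d"
  obtains t K L where "K 0 = 0" "L 0 = 0" "K t = r" "L t = s"
    "\<And>q. q < t \<Longrightarrow> merge_step u r c s d (K q, L q) (K (Suc q), L (Suc q))"
    "max r s \<le> t" "t \<le> r + s"
proof -
  have "(merge_step u r c s d)\<^sup>*\<^sup>* (0, 0) (r, s)"
  proof (rule rtranclp_merge_step[OF assms])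
    show "\<not> dominated u (c (Suc 0)) (d 0)" if "0 < r"
      using c d that dominated_trans[of u "c (Suc 0)" "d 0" "c 0"] by (auto simp: growing_chain_def)
    show "\<not> dominated u (d (Suc 0)) (c 0)" if "0 < s"
      using c d that dominated_trans[of u "d (Suc 0)" "c 0" "d 0"] by (auto simp: growing_chain_def)
  qed auto
  then obtain t f where f: "f 0 = (0, 0)" "f t = (r, s)" "\<And>q. q < t \<Longrightarrow> merge_step u r c s d (f q) (f (Suc q))"
    unfolding rtranclp_power relpowp_fun_conv by blast
  define K L where "K = (\<lambda>q. fst (f q))" and "L = (\<lambda>q. snd (f q))"
  have step: "merge_step u r c s d (K q, L q) (K (Suc q), L (Suc q))" if "q < t" for q
    using f(3)[OF that] by (simp add: K_def L_def)
  \<comment> \<open>The first two bounds hold because an index moves by at most one, the third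
    because at least one of them moves. At \<open>q = t\<close> they become the bounds on the
    rank.\<close>
  have "q \<le> t \<longrightarrow> K q \<le> q \<and> L q \<le> q \<and> q \<le> K q + L q" for q
  proof (induction q)
    case (Suc q)
    then show ?case using step[of q] by (auto simp: merge_step_def)
  qed (simp add: K_def L_def f(1))
  from this[of t] have "max r s \<le> t" "t \<le> r + s" using f by (auto simp: K_def L_def)
  then show thesis using that[of K L t] f step by (auto simp: K_def L_def)
qed

section \<open>The cascade of a refining chain of functions\<close>

text \<open>The nodes of level \<open>q\<close> are to be the fibres of \<open>e q\<close> on
  \<open>A\<close>. \<open>e_0\<close> gives a single root, and \<open>e_top\<close> makes the
  fibres of the last level singletons, that is, leaves.\<close>

locale refining_chain =
  fixes A :: "nat set" and t :: nat and e :: "nat \<Rightarrow> nat \<Rightarrow> nat"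
  assumes A_nonempty: "A \<noteq> {}"
    and e_0: "x \<in> A \<Longrightarrow> y \<in> A \<Longrightarrow> e 0 x = e 0 y"
    and e_Suc: "x \<in> A \<Longrightarrow> y \<in> A \<Longrightarrow> q < t \<Longrightarrow> e (Suc q) x = e (Suc q) y \<Longrightarrow> e q x = e q y"
    and e_top: "inj_on (e t) A"
    and e_infinite: "x \<in> A \<Longrightarrow> q < t \<Longrightarrow> infinite (e (Suc q) ` {y \<in> A. e q y = e q x})"
begin

lemma e_cong:
  assumes "x \<in> A" "y \<in> A" "p \<le> q" "q \<le> t" "e q x = e q y"
  shows "e p x = e p y"
  using assms(3-5)
proof (induction q rule: dec_induct)
  case (step q)
  then show ?case using e_Suc[OF assms(1,2), of q] by simp
qed

text \<open>The tag \<open>q\<close> separates levels on which \<open>e\<close> may take the same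
  values. On the last level the node has to be the natural number \<open>x\<close> itself.\<close>

definition nd :: "nat \<Rightarrow> nat \<Rightarrow> nat + nat list" where
  "nd q x = (if q = t then Inl x else Inr [q, e q x])"

definition level :: "nat + nat list \<Rightarrow> nat" where
  "level v = (case v of Inl x \<Rightarrow> t | Inr l \<Rightarrow> hd l)"

text \<open>Any enumeration of the successors serves as \<open>child\<close>: they all have the same
  rank, so it is monotone, and \<open>branching\<close> does not depend on it.\<close>

definition tree :: "(nat + nat list) cascade" where
  "tree = \<lparr>nodes = {nd q x | q x. q \<le> t \<and> x \<in> A},
     le_node = (\<lambda>v w. \<exists>x\<in>A. \<exists>p q. p \<le> q \<and> q \<le> t \<and> v = nd p x \<and> w = nd q x),
     child = (\<lambda>v. from_nat_into {nd (Suc q) y | q y. q < t \<and> y \<in> A \<and> v = nd q y})\<rparr>"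

lemma level_nd [simp]: "level (nd q x) = q"
  by (simp add: level_def nd_def)

lemma nd_eq_iff:
  assumes "x \<in> A" "y \<in> A"
  shows "nd p x = nd q y \<longleftrightarrow> p = q \<and> e p x = e p y"
proof (cases "p = q")
  case True
  then show ?thesis using e_top assms by (auto simp: nd_def inj_on_def)
next
  case False
  then show ?thesis by (metis level_nd)
qed

lemma nodes_tree: "nodes tree = {nd q x | q x. q \<le> t \<and> x \<in> A}"
  by (simp add: tree_def)

lemma nodesE:
  assumes "v \<in> nodes tree"
  obtains q x where "q \<le> t" "x \<in> A" "v = nd q x"
  using assms by (auto simp: nodes_tree)

lemma nd_in_nodes: "q \<le> t \<Longrightarrow> x \<in> A \<Longrightarrow> nd q x \<in> nodes tree"
  by (auto simp: nodes_tree)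

lemma le_nd_iff:
  assumes "x \<in> A" "y \<in> A" "q \<le> t"
  shows "le_node tree (nd p x) (nd q y) \<longleftrightarrow> p \<le> q \<and> e p x = e p y"
proof
  assume "le_node tree (nd p x) (nd q y)"
  then obtain z p' q' where z: "z \<in> A" "p' \<le> q'" "q' \<le> t" "nd p x = nd p' z" "nd q y = nd q' z"
    unfolding tree_def by auto
  then have "p = p'" "q = q'" "e p x = e p z" "e q y = e q z"
    using assms nd_eq_iff by auto
  then show "p \<le> q \<and> e p x = e p y"
    using e_cong[of y z p q] z assms by auto
next
  assume "p \<le> q \<and> e p x = e p y"
  then have "p \<le> q" "nd p x = nd p y" using nd_eq_iff assms by auto
  then show "le_node tree (nd p x) (nd q y)"
    using assms unfolding tree_def by auto
qed

lemma less_nd_iff: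
  assumes "x \<in> A" "y \<in> A" "q \<le> t"
  shows "less_node tree (nd p x) (nd q y) \<longleftrightarrow> p < q \<and> e p x = e p y"
  unfolding less_node_def le_nd_iff[OF assms] nd_eq_iff[OF assms(1,2)] by (auto simp: order_less_le)

lemma less_level:
  assumes "v \<in> nodes tree" "w \<in> nodes tree" "less_node tree v w"
  shows "level v < level w"
proof -
  obtain p x q y where "p \<le> t" "x \<in> A" "v = nd p x" "q \<le> t" "y \<in> A" "w = nd q y"
    using assms(1,2) by (metis nodesE)
  then show ?thesis using assms(3) less_nd_iff by auto
qed

lemma below_nd:
  assumes "v \<in> nodes tree" "y \<in> A" "q \<le> t" "le_node tree v (nd q y)"
  shows "v = nd (level v) y" "level v \<le> q"
proof -
  obtain p x where p: "p \<le> t" "x \<in> A" "v = nd p x"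
    using assms(1) by (rule nodesE)
  then have "p \<le> q \<and> e p x = e p y" using assms le_nd_iff by auto
  then show "v = nd (level v) y" "level v \<le> q"
    using p assms nd_eq_iff by auto
qed

lemma is_tree_tree: "is_tree tree"
  unfolding is_tree_def
proof (intro conjI ballI)
  show "reflp_on (nodes tree) (le_node tree)"
    by (rule reflp_onI) (auto simp: nodes_tree le_nd_iff)
  show "antisymp_on (nodes tree) (le_node tree)"
  proof (rule antisymp_onI)
    fix v w assume v: "v \<in> nodes tree" "w \<in> nodes tree" "le_node tree v w" "le_node tree w v"
    obtain p x where "p \<le> t" "x \<in> A" "v = nd p x" using v(1) by (rule nodesE)
    moreover obtain q y where "q \<le> t" "y \<in> A" "w = nd q y" using v(2) by (rule nodesE)
    ultimately show "v = w" using v(3,4) by (simp add: le_nd_iff nd_eq_iff)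
  qed
  show "transp_on (nodes tree) (le_node tree)"
  proof (rule transp_onI)
    fix v w z assume v: "v \<in> nodes tree" "w \<in> nodes tree" "z \<in> nodes tree" "le_node tree v w" "le_node tree w z"
    obtain p x where p: "p \<le> t" "x \<in> A" "v = nd p x" using v(1) by (rule nodesE)
    obtain q y where q: "q \<le> t" "y \<in> A" "w = nd q y" using v(2) by (rule nodesE)
    obtain r a where r: "r \<le> t" "a \<in> A" "z = nd r a" using v(3) by (rule nodesE)
    have "p \<le> q" "e p x = e p y" "q \<le> r" "e q y = e q a"
      using v(4,5) p q r by (simp_all add: le_nd_iff)
    then show "le_node tree v z"
      using p q r e_cong[of y a p q] by (simp add: le_nd_iff)
  qed
next
  fix v assume "v \<in> nodes tree"
  then obtain q y where v: "q \<le> t" "y \<in> A" "v = nd q y" by (rule nodesE)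
  show "totalp_on {w \<in> nodes tree. less_node tree w v} (less_node tree)"
  proof (rule totalp_onI)
    fix w z
    assume w: "w \<in> {w \<in> nodes tree. less_node tree w v}" "z \<in> {w \<in> nodes tree. less_node tree w v}" "w \<noteq> z"
    then have "w = nd (level w) y" "level w \<le> q" "z = nd (level z) y" "level z \<le> q"
      using below_nd[of _ y q] v by (auto simp: less_node_def)
    then show "less_node tree w z \<or> less_node tree z w"
      using w(3) v less_nd_iff[of y y]
      by (metis le_trans linorder_neqE_nat)
  qed
  show "wfp_on {w \<in> nodes tree. less_node tree w v} (less_node tree)"
    by (rule wfp_on_if_convertible_to_wfp_on[of level _ "(<)"]) (auto intro: less_level)
qed

lemma root_le:
  assumes "x \<in> A" "v \<in> nodes tree"
  shows "le_node tree (nd 0 x) v"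
  using assms(2)
proof (rule nodesE)
  fix q y assume "q \<le> t" "y \<in> A" "v = nd q y"
  then show ?thesis using assms e_0[of x y] by (simp add: le_nd_iff)
qed

lemma root_tree: "x \<in> A \<Longrightarrow> root_node tree = nd 0 x"
  unfolding root_node_def
proof (rule the_equality)
  assume x: "x \<in> A"
  show "nd 0 x \<in> nodes tree \<and> (\<forall>v\<in>nodes tree. le_node tree (nd 0 x) v)"
    using x root_le nd_in_nodes by auto
  fix v assume v: "v \<in> nodes tree \<and> (\<forall>w\<in>nodes tree. le_node tree v w)"
  then have "le_node tree v (nd 0 x)" using x nd_in_nodes by auto
  then show "v = nd 0 x" using below_nd[of v x 0] v x by auto
qed

lemma is_cascade_tree: "is_cascade tree"
  unfolding is_cascade_def
proof (intro conjI allI impI)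
  show "is_tree tree" by (rule is_tree_tree)
  show "\<exists>r\<in>nodes tree. \<forall>v\<in>nodes tree. le_node tree r v"
    using A_nonempty root_le nd_in_nodes by blast
  fix B assume "pred_on.maxchain (nodes tree) (less_node tree) B"
  then have B: "B \<subseteq> nodes tree" "\<And>v w. v \<in> B \<Longrightarrow> w \<in> B \<Longrightarrow> less_node tree v w \<or> v = w \<or> less_node tree w v"
    unfolding pred_on.maxchain_def pred_on.chain_def by blast+
  have "inj_on level B"
  proof (rule inj_onI)
    fix v w assume "v \<in> B" "w \<in> B" "level v = level w"
    then show "v = w" using B less_level[of v w] less_level[of w v] by auto
  qed
  moreover have "level ` B \<subseteq> {..t}"
    using B(1) by (auto simp: nodes_tree)
  ultimately show "finite B" by (meson finite_atMost finite_imageD finite_subset)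
qed

lemma max_nodes_tree: "max_nodes tree = Inl ` A"
proof (intro equalityI subsetI)
  fix v assume v: "v \<in> max_nodes tree"
  then have "v \<in> nodes tree" by (simp add: max_nodes_def)
  then obtain q x where q: "q \<le> t" "x \<in> A" "v = nd q x" by (rule nodesE)
  have "q = t"
  proof (rule ccontr)
    assume "q \<noteq> t"
    then have "less_node tree v (nd (Suc q) x)" "nd (Suc q) x \<in> nodes tree"
      using q by (auto simp: less_nd_iff nd_in_nodes)
    with v show False by (auto simp: max_nodes_def)
  qed
  with q show "v \<in> Inl ` A" by (simp add: nd_def)
next
  fix v :: "nat + nat list" assume "v \<in> Inl ` A"
  then obtain x where x: "x \<in> A" "v = nd t x" by (auto simp: nd_def)
  have "\<not> less_node tree v w" if "w \<in> nodes tree" for w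
    using less_level[of v w] that x nd_in_nodes by (auto simp: nodes_tree)
  with x show "v \<in> max_nodes tree" by (auto simp: max_nodes_def nd_in_nodes)
qed

lemma nd_max_iff: "x \<in> A \<Longrightarrow> q \<le> t \<Longrightarrow> nd q x \<in> max_nodes tree \<longleftrightarrow> q = t"
  unfolding max_nodes_tree by (auto simp: nd_def)

lemma leaves_tree: "leaves tree = A"
  by (auto simp: leaves_def max_nodes_tree)

lemma succs_tree:
  assumes "x \<in> A" "q < t"
  shows "succs tree (nd q x) = nd (Suc q) ` {y \<in> A. e q y = e q x}"
proof (intro equalityI subsetI)
  fix w assume w: "w \<in> succs tree (nd q x)"
  then have "w \<in> nodes tree" by (simp add: succs_def)
  then obtain p y where p: "p \<le> t" "y \<in> A" "w = nd p y" by (rule nodesE)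
  have qp: "q < p" "e q x = e q y"
    using w p assms by (auto simp: succs_def less_nd_iff)
  have "p = Suc q"
  proof (rule ccontr)
    assume "p \<noteq> Suc q"
    then have "less_node tree (nd q x) (nd (Suc q) y)" "less_node tree (nd (Suc q) y) w"
      "nd (Suc q) y \<in> nodes tree"
      using p qp assms by (auto simp: less_nd_iff nd_in_nodes)
    with w show False by (auto simp: succs_def)
  qed
  with p qp show "w \<in> nd (Suc q) ` {y \<in> A. e q y = e q x}" by simp
next
  fix w assume "w \<in> nd (Suc q) ` {y \<in> A. e q y = e q x}"
  then obtain y where y: "y \<in> A" "e q y = e q x" "w = nd (Suc q) y" by blast
  have "\<not> (less_node tree (nd q x) v \<and> less_node tree v w)" if "v \<in> nodes tree" for v
    using less_level[of "nd q x" v] less_level[of v w] that y assms nd_in_nodes by fastforce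
  then show "w \<in> succs tree (nd q x)"
    using y assms by (auto simp: succs_def less_nd_iff nd_in_nodes)
qed

lemma finite_nd_image_iff:
  assumes "Y \<subseteq> A"
  shows "finite (nd q ` Y) \<longleftrightarrow> finite (e q ` Y)"
proof -
  have eq: "nd q x = nd q y \<longleftrightarrow> e q x = e q y" if "x \<in> Y" "y \<in> Y" for x y
    using nd_eq_iff that assms by blast
  have "\<exists>g. \<forall>x\<in>Y. e q x = g (nd q x)" "\<exists>h. \<forall>x\<in>Y. nd q x = h (e q x)"
    by (rule ex_factor, simp add: eq)+
  then obtain g h where gh: "\<forall>x\<in>Y. e q x = g (nd q x)" "\<forall>x\<in>Y. nd q x = h (e q x)" by blast
  have "e q ` Y = g ` nd q ` Y" "nd q ` Y = h ` e q ` Y"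
    using gh by (auto simp: image_image intro!: image_cong)
  then show ?thesis by (metis finite_imageI)
qed

lemma infinite_succs_tree:
  assumes "x \<in> A" "q < t"
  shows "infinite (succs tree (nd q x))"
  using e_infinite[OF assms] by (simp add: succs_tree[OF assms] finite_nd_image_iff)

lemma not_maxE:
  assumes "v \<in> nodes tree - max_nodes tree"
  obtains q x where "q < t" "x \<in> A" "v = nd q x"
proof -
  obtain q x where "q \<le> t" "x \<in> A" "v = nd q x" using assms by (auto elim: nodesE)
  then show thesis using that assms nd_max_iff by (metis DiffD2 le_neq_implies_less)
qed

lemma child_tree:
  assumes "x \<in> A" "q < t"
  shows "child tree (nd q x) = from_nat_into (succs tree (nd q x))"
proof -
  have "{nd (Suc q') y | q' y. q' < t \<and> y \<in> A \<and> nd q x = nd q' y} = succs tree (nd q x)"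
    unfolding succs_tree[OF assms]
  proof (intro equalityI subsetI)
    fix w assume "w \<in> {nd (Suc q') y | q' y. q' < t \<and> y \<in> A \<and> nd q x = nd q' y}"
    then show "w \<in> nd (Suc q) ` {y \<in> A. e q y = e q x}" using assms by (auto simp: nd_eq_iff)
  next
    fix w assume "w \<in> nd (Suc q) ` {y \<in> A. e q y = e q x}"
    then obtain y where y: "y \<in> A" "e q y = e q x" "w = nd (Suc q) y" by blast
    then have "nd q x = nd q y" using assms nd_eq_iff by simp
    with y assms show "w \<in> {nd (Suc q') y | q' y. q' < t \<and> y \<in> A \<and> nd q x = nd q' y}" by blast
  qed
  then show ?thesis by (simp add: tree_def)
qed

lemma rank_tree:
  assumes "x \<in> A" "q \<le> t"
  shows "rank_node tree (nd q x) = ord_of_nat (t - q)"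
  using assms(2,1)
proof (induction q arbitrary: x rule: inc_induct)
  case base
  then show ?case by (simp add: rank_node_max[OF is_cascade_tree] nd_max_iff)
next
  case (step q)
  have "rank_node tree (nd q x) = (LEAST a. \<forall>w\<in>succs tree (nd q x). rank_node tree w < a)"
    using step by (intro rank_node_not_max[OF is_cascade_tree]) (auto simp: nd_in_nodes nd_max_iff)
  also have "\<dots> = (LEAST a. ord_of_nat (t - Suc q) < a)"
    using step by (intro arg_cong[where f = Least]) (auto simp: succs_tree)
  also have "\<dots> = ord_of_nat (t - q)"
    using step(2) by (simp add: Suc_diff_Suc flip: ord_of_nat.simps(2))
  finally show ?case .
qed

lemma cascade_rank_tree: "cascade_rank tree = ord_of_nat t"
proof -
  obtain x where "x \<in> A" using A_nonempty by blast
  then show ?thesis using rank_tree[of x 0] by (simp add: cascade_rank_def root_tree[of x])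
qed

sublocale tree: sequential_cascade tree
proof
  show "max_nodes tree \<subseteq> range Inl" by (auto simp: max_nodes_tree)
  have "nodes tree \<subseteq> (\<lambda>(q, x). nd q x) ` UNIV" by (auto simp: nodes_tree)
  then have "countable (nodes tree)" by (rule countable_subset) simp
  then have countable: "countable (succs tree v)" for v
    by (rule countable_subset[rotated]) (auto simp: succs_def)
  show "monotone_sequential tree"
    unfolding monotone_sequential_def sequential_def
  proof (intro conjI ballI)
    show "is_cascade tree" by (rule is_cascade_tree)
  next
    fix v assume "v \<in> nodes tree - max_nodes tree"
    then obtain q x where v: "q < t" "x \<in> A" "v = nd q x" by (rule not_maxE)
    show "countable (succs tree v)" by (rule countable)
    show inf: "infinite (succs tree v)" using v infinite_succs_tree by simp
    show bij: "bij_betw (child tree v) UNIV (succs tree v)"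
      using bij_betw_from_nat_into[OF countable inf] v child_tree by simp
    have "child tree v i \<in> succs tree v" for i
      using bij by (auto simp: bij_betw_def)
    moreover have "rank_node tree w = ord_of_nat (t - Suc q)" if "w \<in> succs tree v" for w
      using that v rank_tree[of _ "Suc q"] by (auto simp: succs_tree)
    ultimately have "rank_node tree (child tree v i) = ord_of_nat (t - Suc q)" for i
      by blast
    then show "mono (\<lambda>i. rank_node tree (child tree v i))" by (simp add: mono_def)
  qed
qed

lemma up_nd: "x \<in> A \<Longrightarrow> y \<in> A \<Longrightarrow> q \<le> t \<Longrightarrow> y \<in> up tree (nd q x) \<longleftrightarrow> e q y = e q x"
  using le_nd_iff[of x y t q] by (auto simp: up_def nd_def)

text \<open>Each branching uses up a level, since the sets counted at the next stage lie above
  successors of the branching node.\<close>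

lemma branching_tree_bound:
  assumes "branching tree k U" "U \<subseteq> A \<inter> up tree (nd q x)" "x \<in> A" "q \<le> t"
  shows "q + k \<le> t"
  using assms
proof (induction k arbitrary: U q x)
  case (Suc k)
  then obtain v where v: "v \<in> nodes tree - max_nodes tree"
    "infinite {w \<in> succs tree v. branching tree k (U \<inter> up tree w)}" by auto
  obtain p y where p: "p < t" "y \<in> A" "v = nd p y" using v(1) by (rule not_maxE)
  define X where "X = {w \<in> succs tree v. branching tree k (U \<inter> up tree w)}"
  have X: "\<exists>z\<in>A. w = nd (Suc p) z" "U \<inter> up tree w \<noteq> {}" if "w \<in> X" for w
    using that p branching_empty[of tree k] by (auto simp: X_def succs_tree)
  \<comment> \<open>Below level \<open>q\<close> the fibre of \<open>x\<close> is not yet split: all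
    of \<open>U\<close> lies above a single node of level \<open>Suc p\<close>, so infinitely many
    successors could not meet it.\<close>
  have "q \<le> p"
  proof (rule ccontr)
    assume "\<not> q \<le> p"
    have "w = nd (Suc p) x" if w: "w \<in> X" for w
    proof -
      obtain z where z: "z \<in> A" "w = nd (Suc p) z" using X(1)[OF w] by blast
      obtain a where a: "a \<in> U" "a \<in> up tree w" using X(2)[OF w] by blast
      have "a \<in> A" "a \<in> up tree (nd q x)" using a(1) Suc.prems(2) by auto
      then have "e q a = e q x" using up_nd[of x a q] Suc.prems(3,4) by simp
      then have "e (Suc p) a = e (Suc p) x"
        using e_cong[of a x "Suc p" q] \<open>a \<in> A\<close> Suc.prems(3,4) \<open>\<not> q \<le> p\<close> by simp
      moreover have "e (Suc p) a = e (Suc p) z"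
        using up_nd[of z a "Suc p"] z a(2) p(1) \<open>a \<in> A\<close> by simp
      ultimately show ?thesis using z Suc.prems(3) nd_eq_iff by simp
    qed
    then have "X \<subseteq> {nd (Suc p) x}" by blast
    then have "finite X" by (rule finite_subset) simp
    then show False using v(2) unfolding X_def by blast
  qed
  have "X \<noteq> {}" using v(2) unfolding X_def[symmetric] by auto
  then obtain w where w: "w \<in> X" by blast
  then obtain z where z: "z \<in> A" "w = nd (Suc p) z" using X(1) by blast
  have "Suc p + k \<le> t"
    using w z p Suc.prems(2) by (intro Suc.IH[of "U \<inter> up tree w" "Suc p" z]) (auto simp: X_def)
  with \<open>q \<le> p\<close> show ?case by simp
qed simp

lemma ex_not_branching_tree:
  assumes "U \<subseteq> A"
  shows "\<exists>k. \<not> branching tree k U"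
proof -
  obtain x where x: "x \<in> A" using A_nonempty by blast
  have "y \<in> up tree (nd 0 x)" if "y \<in> U" for y
    using up_nd[of x y 0] e_0[of y x] x assms that by auto
  with assms have "U \<subseteq> A \<inter> up tree (nd 0 x)" by blast
  then have "\<not> branching tree (Suc t) U"
    using branching_tree_bound[of "Suc t" U 0 x] x by auto
  then show ?thesis by blast
qed

text \<open>An open set \<open>S\<close> around the root is followed level by level. A node in
  \<open>S\<close> misses only finitely many successors, and almost every leaf has a next value of
  \<open>e\<close> beyond all of these.\<close>

lemma le_contour_tree:
  assumes A: "eventually (\<lambda>x. x \<in> A) u"
    and unbounded: "\<And>q f. q < t \<Longrightarrow> eventually (\<lambda>x. f (e q x) < e (Suc q) x) u"
  shows "u \<le> contour tree"
proof (rule filter_leI)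
  fix P assume "eventually P (contour tree)"
  then obtain S where S: "openin (cascade_topology tree) S" "root_node tree \<in> S"
    "\<And>x. Inl x \<in> S \<inter> max_nodes tree \<Longrightarrow> P x"
    unfolding eventually_contour[OF tree.root(1)] by blast
  have "q \<le> t \<longrightarrow> eventually (\<lambda>x. nd q x \<in> S) u" for q
  proof (induction q)
    case 0
    have "nd 0 x \<in> S" if "x \<in> A" for x using S(2) root_tree[OF that] by simp
    with A show ?case by (auto elim: eventually_mono)
  next
    case (Suc q)
    show ?case
    proof
      assume q: "Suc q \<le> t"
      \<comment> \<open>The largest value belonging to a missed successor. For nodes outside
        \<open>S\<close> the set may be infinite and the value of \<open>Max\<close> meaningless,
        but only nodes in \<open>S\<close> are consulted.\<close>
      define f where "f = (\<lambda>a. Max (e (Suc q) ` {y \<in> A. e q y = a \<and> nd (Suc q) y \<notin> S}))"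
      have "eventually (\<lambda>x. nd q x \<in> S) u" "eventually (\<lambda>x. f (e q x) < e (Suc q) x) u"
        using Suc unbounded[of q f] q by auto
      with A show "eventually (\<lambda>x. nd (Suc q) x \<in> S) u"
      proof eventually_elim
        case (elim x)
        show ?case
        proof (rule ccontr)
          assume no: "nd (Suc q) x \<notin> S"
          have "finite (succs tree (nd q x) - S)"
            using S(1) elim q unfolding openin_cascade_topology by (auto simp: nd_max_iff)
          moreover have "nd (Suc q) ` {y \<in> A. e q y = e q x \<and> nd (Suc q) y \<notin> S} \<subseteq> succs tree (nd q x) - S"
            using q elim by (auto simp: succs_tree)
          ultimately have "finite (nd (Suc q) ` {y \<in> A. e q y = e q x \<and> nd (Suc q) y \<notin> S})"
            by (rule finite_subset[rotated])
          then have "finite (e (Suc q) ` {y \<in> A. e q y = e q x \<and> nd (Suc q) y \<notin> S})"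
            by (subst (asm) finite_nd_image_iff) auto
          then have "e (Suc q) x \<le> f (e q x)"
            unfolding f_def using elim no by (intro Max_ge) auto
          with elim show False by simp
        qed
      qed
    qed
  qed
  from this[of t] have "eventually (\<lambda>x. nd t x \<in> S) u" by simp
  with A show "eventually P u"
  proof eventually_elim
    case (elim x)
    then show ?case using S(3)[of x] by (auto simp: nd_def max_nodes_tree)
  qed
qed

end

section \<open>Contours and orders of dominated cascades\<close>

text \<open>The assumption \<open>e_bound\<close> says that, above a node of level \<open>q\<close> of the tree, fixing the node
  of \<open>V\<close> on level \<open>K q + 1\<close> leaves only finitely many successors.\<close>

locale dominating_tree = full_branches V B r anc + refining_chain A t e
  for V :: "(nat + 'a) cascade" and B r anc A t e +
  fixes K :: "nat \<Rightarrow> nat" and F :: "nat \<Rightarrow> nat \<Rightarrow> nat"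
  assumes A_sub: "A \<subseteq> B"
    and K_0: "K 0 = 0" and K_top: "K t = r"
    and K_less: "q < t \<Longrightarrow> K q < r"
    and K_Suc: "q < t \<Longrightarrow> K (Suc q) = K q \<or> K (Suc q) = Suc (K q)"
    and e_code: "x \<in> A \<Longrightarrow> y \<in> A \<Longrightarrow> q \<le> t \<Longrightarrow> e q x = e q y \<Longrightarrow> code (K q) x = code (K q) y"
    and e_bound: "x \<in> A \<Longrightarrow> q < t \<Longrightarrow> e (Suc q) x \<le> F q (code (Suc (K q)) x)"
begin

lemma K_le: "q \<le> t \<Longrightarrow> K q \<le> r"
  using K_less[of q] K_top by (cases "q = t") auto

lemma e_anc: "x \<in> A \<Longrightarrow> y \<in> A \<Longrightarrow> q \<le> t \<Longrightarrow> e q x = e q y \<Longrightarrow> anc (K q) x = anc (K q) y"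
  using e_code[of x y q] code_eq_iff[of x y "K q"] A_sub by auto

text \<open>\<open>code\<close> factors through \<open>anc\<close>, so \<open>Y\<close> has finitely
  many codes, and by \<open>e_bound\<close> each of them admits only finitely many values of
  \<open>e (Suc q)\<close>.\<close>

lemma finite_nd_image:
  assumes "Y \<subseteq> A" "q < t" "finite (anc (Suc (K q)) ` Y)"
  shows "finite (nd (Suc q) ` Y)"
proof -
  let ?k = "Suc (K q)"
  have "code ?k ` Y = (\<lambda>v. LEAST y. y \<in> B \<and> anc ?k y = v) ` anc ?k ` Y"
    by (simp add: image_image code_def)
  with assms(3) have "finite (code ?k ` Y)" by simp
  then have "finite (\<Union>a\<in>code ?k ` Y. {..F q a})" by (rule finite_UN_I) simp
  moreover have "e (Suc q) ` Y \<subseteq> (\<Union>a\<in>code ?k ` Y. {..F q a})"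
    using e_bound[of _ q] assms(1,2) by auto
  ultimately have "finite (e (Suc q) ` Y)" by (rule finite_subset[rotated])
  then show ?thesis using finite_nd_image_iff[OF assms(1)] by simp
qed

text \<open>The map taking \<open>nd q x\<close> to \<open>anc (K q) x\<close> is well defined by
  \<open>e_anc\<close>, and the preimage \<open>S'\<close> of an open set is open: finitely many
  lost successors in \<open>V\<close> account for finitely many in the tree.\<close>

lemma contour_tree_le: "contour tree \<le> contour V"
proof (rule filter_leI)
  fix P assume "eventually P (contour V)"
  then obtain S where S: "openin (cascade_topology V) S" "root_node V \<in> S"
    "\<And>x. Inl x \<in> S \<inter> max_nodes V \<Longrightarrow> P x"
    unfolding eventually_contour[OF root(1)] by blast
  define S' where "S' = {nd q x | q x. q \<le> t \<and> x \<in> A \<and> anc (K q) x \<in> S}"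
  have S'_iff: "nd q x \<in> S' \<longleftrightarrow> anc (K q) x \<in> S" if "q \<le> t" "x \<in> A" for q x
  proof
    assume "nd q x \<in> S'"
    then obtain p y where py: "p \<le> t" "y \<in> A" "anc (K p) y \<in> S" "nd q x = nd p y"
      by (auto simp: S'_def)
    then have "p = q" "e q x = e q y" using nd_eq_iff that by auto
    with py show "anc (K q) x \<in> S" using e_anc[of x y q] that by simp
  qed (use that in \<open>auto simp: S'_def\<close>)
  have "openin (cascade_topology tree) S'"
    unfolding openin_cascade_topology
  proof (intro conjI ballI)
    show "S' \<subseteq> nodes tree" by (auto simp: S'_def nodes_tree)
    fix v assume v: "v \<in> S' - max_nodes tree"
    then have "v \<in> nodes tree - max_nodes tree" by (auto simp: S'_def nodes_tree)
    then obtain q x where qx: "q < t" "x \<in> A" "v = nd q x" by (rule not_maxE)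
    let ?w = "anc (K q) x"
    have w: "?w \<in> S" using v qx S'_iff[of q x] by simp
    have "?w \<in> nodes V - max_nodes V" using anc_not_max K_less qx A_sub by blast
    with w S(1) have fin: "finite (succs V ?w - S)"
      unfolding openin_cascade_topology by blast
    define Y where "Y = {y \<in> A. e q y = e q x \<and> nd (Suc q) y \<notin> S'}"
    have "anc (Suc (K q)) ` Y \<subseteq> succs V ?w - S"
    proof safe
      fix y assume "y \<in> Y"
      then have y: "y \<in> A" "e q y = e q x" "nd (Suc q) y \<notin> S'" by (auto simp: Y_def)
      have yw: "anc (K q) y = ?w" using e_anc[of y x q] y qx by simp
      show "anc (Suc (K q)) y \<in> succs V ?w"
        using anc_Suc[of y "K q"] yw y(1) A_sub K_less[OF qx(1)] by auto
      have "anc (K (Suc q)) y \<notin> S" using y S'_iff[of "Suc q" y] qx by simp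
      moreover assume "anc (Suc (K q)) y \<in> S"
      \<comment> \<open>If \<open>K\<close> stays put, the ancestor of \<open>y\<close> is still
        \<open>?w\<close>, which lies in \<open>S\<close>; if it moves, the ancestor is the
        successor assumed to lie in \<open>S\<close>.\<close>
      ultimately show False using K_Suc[OF qx(1)] yw w by auto
    qed
    then have "finite (anc (Suc (K q)) ` Y)" using fin by (rule finite_subset)
    then have "finite (nd (Suc q) ` Y)"
      by (intro finite_nd_image qx(1)) (auto simp: Y_def)
    moreover have "succs tree v - S' \<subseteq> nd (Suc q) ` Y"
      using qx by (auto simp: succs_tree Y_def)
    ultimately show "finite (succs tree v - S')" by (rule finite_subset[rotated])
  qed
  moreover have "root_node tree \<in> S'"
  proof -
    obtain x where x: "x \<in> A" using A_nonempty by blast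
    then have "anc (K 0) x \<in> S" using anc_0[of x] A_sub S(2) K_0 by auto
    then show ?thesis using S'_iff[of 0 x] root_tree[OF x] x by simp
  qed
  moreover have "P x" if "Inl x \<in> S' \<inter> max_nodes tree" for x
  proof -
    have x: "x \<in> A" using that by (auto simp: max_nodes_tree)
    then have "nd t x \<in> S'" using that by (simp add: nd_def)
    then have "Inl x \<in> S" using S'_iff[of t x] x K_top anc_top[of x] A_sub by auto
    moreover have "Inl x \<in> max_nodes V" using x A_sub A_leaves by (auto simp: leaves_def)
    ultimately show ?thesis using S(3) by blast
  qed
  ultimately show "eventually P (contour tree)"
    unfolding eventually_contour[OF tree.root(1)] by blast
qed

text \<open>A search along the levels of the tree for the node that takes over the branching of
  \<open>v\<close>. At \<open>nd q x\<close>, either infinitely many successors carry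
  \<open>k\<close>-fold branching and the search ends, or by the pigeonhole principle one successor
  serves infinitely many \<open>w\<close> in \<open>Y\<close> and the search goes on above it. It
  cannot reach the last level, as a leaf lies above only one \<open>w\<close>.\<close>

lemma branching_descent:
  assumes U: "U \<subseteq> A" and v: "v \<in> nodes V" "Y \<subseteq> succs V v" and c: "c < r"
    and Y: "\<And>w x. w \<in> Y \<Longrightarrow> x \<in> U \<inter> up V w \<Longrightarrow> w = anc (Suc c) x"
    and "q \<le> t" "x \<in> A"
    and "infinite {w \<in> Y. branching tree k (U \<inter> up V w \<inter> up tree (nd q x))}"
  shows "branching tree (Suc k) U"
  using assms(6-8)
proof (induction q arbitrary: x rule: inc_induct)
  case base
  let ?Z = "{w \<in> Y. branching tree k (U \<inter> up V w \<inter> up tree (nd t x))}"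
  have "w = anc (Suc c) x" if w: "w \<in> ?Z" for w
  proof -
    have "U \<inter> up V w \<inter> up tree (nd t x) \<noteq> {}"
      using w branching_empty[of tree k] by auto
    then obtain y where y: "y \<in> U" "y \<in> up V w" "y \<in> up tree (nd t x)" by blast
    then have "e t y = e t x" using up_nd[of x y t] base U by auto
    then have "y = x" using e_top y U base by (auto simp: inj_on_def)
    then show ?thesis using Y[of w y] w y by blast
  qed
  then have "?Z \<subseteq> {anc (Suc c) x}" by blast
  then have "finite ?Z" by (rule finite_subset) simp
  with base show ?case by blast
next
  case (step q)
  define z where "z = nd q x"
  define Z where "Z = {w \<in> Y. branching tree k (U \<inter> up V w \<inter> up tree z)}"
  have Z: "infinite Z" using step.prems by (simp add: Z_def z_def)
  have zA: "y \<in> A" "e q y = e q x" if "y \<in> U \<inter> up tree z" for y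
    using that U up_nd[of x y q] step by (auto simp: z_def)
  \<comment> \<open>Otherwise the tree node \<open>z\<close> already fixes the ancestor of level
    \<open>Suc c\<close> in \<open>V\<close>, and only one \<open>w\<close> would be left.\<close>
  have "K q \<le> c"
  proof (rule ccontr)
    assume Kc: "\<not> K q \<le> c"
    have "w = anc (Suc c) x" if w: "w \<in> Z" for w
    proof -
      have "U \<inter> up V w \<inter> up tree z \<noteq> {}"
        using w branching_empty[of tree k] by (auto simp: Z_def)
      then obtain y where y: "y \<in> U" "y \<in> up V w" "y \<in> up tree z" by blast
      have "anc (K q) y = anc (K q) x"
        using e_anc[of y x q] zA[of y] y step by simp
      then have "anc (Suc c) y = anc (Suc c) x"
        using anc_cong[of y x "Suc c" "K q"] Kc K_le[of q] step U y A_sub by auto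
      then show ?thesis using Y[of w y] w y by (auto simp: Z_def)
    qed
    then have "Z \<subseteq> {anc (Suc c) x}" by blast
    then have "finite Z" by (rule finite_subset) simp
    with Z show False by blast
  qed
  \<comment> \<open>The leaves of \<open>U\<close> above \<open>w\<close> share the ancestor of
    level \<open>Suc c\<close>, hence that of level \<open>Suc (K q)\<close>. So they spread over
    finitely many successors of \<open>z\<close>, one of which inherits the branching by
    \<open>branching_UN\<close>.\<close>
  have "\<exists>w'\<in>succs tree z. branching tree k (U \<inter> up V w \<inter> up tree w')" if w: "w \<in> Z" for w
  proof -
    define X where "X = U \<inter> up V w \<inter> up tree z"
    have XA: "X \<subseteq> A" using U by (auto simp: X_def)
    have "anc (Suc (K q)) a = anc (Suc (K q)) b" if "a \<in> X" "b \<in> X" for a b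
    proof -
      have "anc (Suc c) a = anc (Suc c) b"
        using Y[of w a] Y[of w b] that w by (auto simp: X_def Z_def)
      then show ?thesis
        using anc_cong[of a b "Suc (K q)" "Suc c"] \<open>K q \<le> c\<close> c that XA A_sub by auto
    qed
    then have "anc (Suc (K q)) ` X \<subseteq> {anc (Suc (K q)) (SOME a. a \<in> X)}"
      by (metis image_subsetI insertI1 someI)
    then have "finite (anc (Suc (K q)) ` X)" by (rule finite_subset) simp
    then have fin: "finite (nd (Suc q) ` X)"
      using finite_nd_image[OF XA] step.hyps by simp
    have "a \<in> up tree (nd (Suc q) a)" if "a \<in> X" for a
      using up_nd[of a a "Suc q"] that XA step.hyps by auto
    then have "X \<subseteq> (\<Union>w'\<in>nd (Suc q) ` X. X \<inter> up tree w')" by blast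
    moreover have "branching tree k X" using w by (simp add: Z_def X_def)
    ultimately have "branching tree k (\<Union>w'\<in>nd (Suc q) ` X. X \<inter> up tree w')"
      by (rule branching_mono[rotated])
    from branching_UN[OF fin this] obtain a where a: "a \<in> X" "branching tree k (X \<inter> up tree (nd (Suc q) a))"
      by blast
    have "nd (Suc q) a \<in> succs tree z"
      using a(1) zA[of a] step.hyps step.prems(1) by (auto simp: z_def succs_tree X_def)
    moreover have "branching tree k (U \<inter> up V w \<inter> up tree (nd (Suc q) a))"
      using a(2) by (rule branching_mono) (auto simp: X_def)
    ultimately show ?thesis by blast
  qed
  moreover have "branching tree k (U \<inter> up tree w')"
    if "branching tree k (U \<inter> up V w \<inter> up tree w')" for w w'
    using that by (rule branching_mono) auto
  ultimately have ex: "\<forall>w\<in>Z. \<exists>w'\<in>{w' \<in> succs tree z. branching tree k (U \<inter> up tree w')}.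
      branching tree k (U \<inter> up V w \<inter> up tree w')"
    by (simp add: Bex_def) blast
  show ?case
  proof (cases "finite {w' \<in> succs tree z. branching tree k (U \<inter> up tree w')}")
    case False
    moreover have "z \<in> nodes tree - max_nodes tree"
      using step.hyps step.prems(1) nd_in_nodes[of q x] nd_max_iff[of x q] by (simp add: z_def)
    ultimately show ?thesis by auto
  next
    case True
    from pigeonhole_infinite_rel[OF Z True ex]
    obtain w' where w': "w' \<in> succs tree z" "infinite {w \<in> Z. branching tree k (U \<inter> up V w \<inter> up tree w')}"
      by blast
    obtain y where y: "y \<in> A" "w' = nd (Suc q) y"
      using w'(1) step.hyps step.prems(1) by (auto simp: z_def succs_tree)
    have "{w \<in> Z. branching tree k (U \<inter> up V w \<inter> up tree w')} \<subseteq>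
        {w \<in> Y. branching tree k (U \<inter> up V w \<inter> up tree (nd (Suc q) y))}"
      using y by (auto simp: Z_def)
    then have "infinite {w \<in> Y. branching tree k (U \<inter> up V w \<inter> up tree (nd (Suc q) y))}"
      using w'(2) infinite_super by blast
    with step.IH[OF y(1)] show ?thesis .
  qed
qed

text \<open>By induction every \<open>w\<close> in \<open>Y\<close> already carries
  \<open>k\<close>-fold branching of the tree. The search of \<open>branching_descent\<close>,
  started at the root of the tree, finds a node for the remaining branching.\<close>

lemma branching_tree:
  assumes "branching V k U" "U \<subseteq> A"
  shows "branching tree k U"
  using assms
proof (induction k arbitrary: U)
  case (Suc k)
  note U = Suc.prems(2)
  obtain v where v: "v \<in> nodes V - max_nodes V"
    "infinite {w \<in> succs V v. branching V k (U \<inter> up V w)}" using Suc.prems by auto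
  define Y where "Y = {w \<in> succs V v. branching V k (U \<inter> up V w)}"
  \<comment> \<open>Leaves in \<open>A\<close> lie on full branches, so \<open>v\<close> has a
    level; it is below \<open>r\<close> because \<open>v\<close> is not maximal.\<close>
  have level: "\<exists>c<r. v = anc c x" if "w \<in> succs V v" "x \<in> U \<inter> up V w" for w x
  proof -
    have x: "x \<in> B" "Inl x \<in> nodes V" "le_node V w (Inl x)"
      using that(2) U A_sub anc_node[of x r] anc_top[of x] by (auto simp: up_def)
    then have "le_node V v (Inl x)"
      using le_trans[of v w "Inl x"] succsD[OF that(1)] v(1) by blast
    then obtain c where "c \<le> r" "v = anc c x"
      using below_anc[of x v r] x anc_top v(1) by auto
    moreover have "c \<noteq> r"
      using \<open>v = anc c x\<close> v(1) anc_top[OF x(1)] x(1) A_leaves by (auto simp: leaves_def)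
    ultimately show ?thesis by (metis le_neq_implies_less)
  qed
  have "Y \<noteq> {}" using v(2) unfolding Y_def[symmetric] by auto
  then obtain w0 where w0: "w0 \<in> Y" by blast
  then have "U \<inter> up V w0 \<noteq> {}" using branching_empty[of V k] by (auto simp: Y_def)
  then obtain x0 where x0: "x0 \<in> U \<inter> up V w0" by blast
  obtain c where c: "c < r" "v = anc c x0" using level[of w0 x0] w0 x0 by (auto simp: Y_def)
  have x0B: "x0 \<in> B" "x0 \<in> A" using x0 U A_sub by auto
  show ?case
  proof (rule branching_descent[of U v Y c 0 x0])
    show "v \<in> nodes V" "Y \<subseteq> succs V v" using v by (auto simp: Y_def)
    fix w x assume w: "w \<in> Y" "x \<in> U \<inter> up V w"
    have xB: "x \<in> B" using w U A_sub by auto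
    obtain c' where c': "c' < r" "v = anc c' x" using level[of w x] w by (auto simp: Y_def)
    then have "c' = c" using anc_level[of x x0 c' c] c xB x0B by simp
    then have "anc (Suc c) x \<in> succs V v" using anc_Suc[of x c] c' xB by simp
    moreover have "le_node V (anc (Suc c) x) (Inl x)"
      using anc_mono[of x "Suc c" r] c anc_top[of x] xB by simp
    moreover have "Inl x \<in> nodes V" using anc_node[of x r] anc_top[of x] xB by simp
    ultimately show "w = anc (Suc c) x"
      using succs_unique_below[of w v "anc (Suc c) x" "Inl x"] w v(1) by (auto simp: Y_def up_def)
  next
    have "branching tree k (U \<inter> up V w \<inter> up tree (nd 0 x0))" if "w \<in> Y" for w
    proof -
      have "U \<inter> up V w \<inter> up tree (nd 0 x0) = U \<inter> up V w"
        using up_nd[of x0 _ 0] x0B U e_0[OF _ x0B(2)] by blast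
      then show ?thesis using Suc.IH[of "U \<inter> up V w"] that U by (auto simp: Y_def)
    qed
    then have "{w \<in> Y. branching tree k (U \<inter> up V w \<inter> up tree (nd 0 x0))} = Y" by blast
    then show "infinite {w \<in> Y. branching tree k (U \<inter> up V w \<inter> up tree (nd 0 x0))}"
      using v(2) by (simp add: Y_def)
  qed (use U c x0B in auto)
qed simp

lemma increases_order_tree: "increases_order tree V"
proof (rule increases_orderI)
  show "leaves tree \<subseteq> leaves V" using A_sub A_leaves by (auto simp: leaves_tree)
  show "\<exists>k. \<not> branching tree k U" if "U \<subseteq> leaves tree" for U
    using ex_not_branching_tree that by (simp add: leaves_tree)
  show "branching tree k U" if "U \<subseteq> leaves tree" "branching V k U" for U k
    using branching_tree that by (simp add: leaves_tree)
qed unfold_locales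

end

section \<open>The common refinement\<close>

lemma (in full_branches) growing_chain_code:
  assumes "u \<noteq> bot" "u \<le> contour V" "eventually (\<lambda>x. x \<in> A) (contour V)"
  shows "growing_chain u r code"
  unfolding growing_chain_def
proof (intro conjI allI impI)
  have A: "eventually (\<lambda>x. x \<in> A) u" using assms(2,3) by (rule filter_leD)
  show "dominated u (code 0) f" for f
    using A by (rule dominated_if_determined) (rule code_0)
  show "dominated u f (code r)" for f
    using A by (rule dominated_if_determined) (simp add: code_top)
  fix k assume k: "k < r"
  show "dominated u (code k) (code (Suc k))"
    using A by (rule dominated_if_determined) (rule code_cong[of _ _ k "Suc k"], use k in auto)
  show "\<not> dominated u (code (Suc k)) (code k)"
  proof
    assume "dominated u (code (Suc k)) (code k)"
    then obtain h where h: "eventually (\<lambda>x. code (Suc k) x \<le> h (code k x)) u"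
      by (auto simp: dominated_def)
    have "eventually (\<lambda>x. h (code k x) < code (Suc k) x) u"
      using code_Suc_unbounded[OF k assms(3)] assms(2) by (blast intro: filter_leD)
    with h have "eventually (\<lambda>x. False) u" by eventually_elim simp
    with assms(1) show False by simp
  qed
qed

text \<open>Leaves over nodes with finitely many remaining successors are negligible for
  \<open>u\<close>, because there \<open>e (Suc q)\<close> is bounded in terms of
  \<open>e q\<close>. Thinning starts at the last level and moves towards the root, so that a later
  removal cannot spoil an earlier level.\<close>

lemma ex_infinitely_branching_subset:
  fixes e :: "nat \<Rightarrow> nat \<Rightarrow> nat"
  assumes "eventually (\<lambda>x. x \<in> A) u"
    and cong: "\<And>x y p q. x \<in> A \<Longrightarrow> y \<in> A \<Longrightarrow> p \<le> q \<Longrightarrow> q \<le> t \<Longrightarrow> e q x = e q y \<Longrightarrow> e p x = e p y"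
    and unbounded: "\<And>q f. q < t \<Longrightarrow> eventually (\<lambda>x. f (e q x) < e (Suc q) x) u"
  shows "\<exists>A'\<subseteq>A. eventually (\<lambda>x. x \<in> A') u \<and>
    (\<forall>x\<in>A'. \<forall>q<t. infinite (e (Suc q) ` {y \<in> A'. e q y = e q x}))"
proof -
  \<comment> \<open>Stage \<open>j\<close> treats the nodes of level \<open>t - Suc j\<close>, whose
    successors have level \<open>t - j\<close>.\<close>
  define G where "G = rec_nat A (\<lambda>j X. {x \<in> X. infinite (e (t - j) ` {y \<in> X. e (t - Suc j) y = e (t - Suc j) x})})"
  have G_0: "G 0 = A" by (simp add: G_def)
  have G_Suc: "G (Suc j) = {x \<in> G j. infinite (e (t - j) ` {y \<in> G j. e (t - Suc j) y = e (t - Suc j) x})}" for j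
    by (simp add: G_def)
  have "antimono G" by (rule decseq_SucI) (auto simp: G_Suc)
  then have G_anti: "G j \<subseteq> G i" if "i \<le> j" for i j using that by (rule antimonoD)
  have ev: "j \<le> t \<longrightarrow> eventually (\<lambda>x. x \<in> G j) u" for j
  proof (induction j)
    case 0
    then show ?case using assms(1) by (simp add: G_0)
  next
    case (Suc j)
    show ?case
    proof
      assume j: "Suc j \<le> t"
      define q where "q = t - Suc j"
      have q: "q < t" "t - j = Suc q" using j by (auto simp: q_def)
      define f where "f = (\<lambda>a. Max (e (Suc q) ` {y \<in> G j. e q y = a}))"
      have "eventually (\<lambda>x. x \<in> G j) u" "eventually (\<lambda>x. f (e q x) < e (Suc q) x) u"
        using Suc j unbounded[OF q(1)] by auto
      then show "eventually (\<lambda>x. x \<in> G (Suc j)) u"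
      proof eventually_elim
        case (elim x)
        have "infinite (e (Suc q) ` {y \<in> G j. e q y = e q x})"
        proof
          assume "finite (e (Suc q) ` {y \<in> G j. e q y = e q x})"
          then have "e (Suc q) x \<le> f (e q x)"
            unfolding f_def using elim by (intro Max_ge) auto
          with elim show False by simp
        qed
        with elim show ?case by (simp add: G_Suc q(2) flip: q_def)
      qed
    qed
  qed
  have "infinite (e (Suc q) ` {y \<in> G t. e q y = e q x})" if x: "x \<in> G t" and q: "q < t" for x q
  proof -
    define j where "j = t - Suc q"
    have j: "Suc j \<le> t" "t - j = Suc q" "t - Suc j = q" using q by (auto simp: j_def)
    have "x \<in> G (Suc j)" using G_anti[OF j(1)] x by blast
    then have inf: "infinite (e (Suc q) ` {y \<in> G j. e q y = e q x})" by (simp add: G_Suc j)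
    \<comment> \<open>Whether a leaf survives a later stage depends only on its value at a level at
      most \<open>q\<close>. So the fibre of \<open>e q\<close> through the surviving leaf
      \<open>x\<close> is kept as a whole.\<close>
    have "y \<in> G i" if y: "y \<in> G j" "e q y = e q x" and "j \<le> i" "i \<le> t" for y i
      using that(3,4)
    proof (induction i rule: dec_induct)
      case base
      then show ?case using y by simp
    next
      case (step i)
      have "x \<in> G (Suc i)" using G_anti[OF step.prems] x by blast
      moreover have "e (t - Suc i) y = e (t - Suc i) x"
      proof (rule cong)
        show "y \<in> A" "x \<in> A" using G_anti[of 0] x y by (auto simp: G_0)
        show "t - Suc i \<le> q" using j step.hyps by linarith
      qed (use q y in auto)
      ultimately show ?case using step by (simp add: G_Suc)
    qed
    then have "{y \<in> G j. e q y = e q x} \<subseteq> {y \<in> G t. e q y = e q x}"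
      using j(1) by auto
    then show ?thesis using inf by (meson finite_subset image_mono)
  qed
  then show ?thesis
    using ev[of t] G_anti[of 0 t] by (intro exI[of _ "G t"]) (auto simp: G_0)
qed

theorem theorem3p5:
  fixes u :: "nat filter"
    and V :: "(nat + 'a) cascade"
    and W :: "(nat + 'b) cascade"
    and n m :: nat
  assumes "ultrafilter u"
    and "monotone_sequential V" and "max_nodes V \<subseteq> range Inl"
    and "monotone_sequential W" and "max_nodes W \<subseteq> range Inl"
    and "cascade_rank V \<in> range ord_of_nat" and "cascade_rank W \<in> range ord_of_nat"
    and "u \<le> contour V" and "u \<le> contour W"
    and "E_rel u n V m W"
  shows "\<exists>T :: (nat + nat list) cascade.
           monotone_sequential T \<and> max_nodes T \<subseteq> range Inl \<and>
           max (cascade_rank V) (cascade_rank W) \<le> cascade_rank T \<and> cascade_rank T \<le> cascade_rank V + cascade_rank W \<and>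
           u \<le> contour T \<and>
           increases_order T V \<and> increases_order T W \<and>
           contour T \<le> contour V \<and> contour T \<le> contour W"
proof -
  have u_bot: "u \<noteq> bot" using assms(1) by (simp add: ultrafilter_def)
  obtain r s where rs: "cascade_rank V = ord_of_nat r" "cascade_rank W = ord_of_nat s"
    using assms(6,7) by blast
  interpret V0: sequential_cascade V by unfold_locales fact+
  interpret W0: sequential_cascade W by unfold_locales fact+
  obtain B anc where V: "full_branches V B r anc" "eventually (\<lambda>x. x \<in> B) (contour V)"
    using V0.ex_full_branches[OF rs(1)] by blast
  obtain C anc' where W: "full_branches W C s anc'" "eventually (\<lambda>x. x \<in> C) (contour W)"
    using W0.ex_full_branches[OF rs(2)] by blast
  interpret V: full_branches V B r anc by fact
  interpret W: full_branches W C s anc' by fact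
  obtain t K L where KL: "K 0 = 0" "L 0 = 0" "K t = r" "L t = s"
    and step: "\<And>q. q < t \<Longrightarrow> merge_step u r V.code s W.code (K q, L q) (K (Suc q), L (Suc q))"
    and t: "max r s \<le> t" "t \<le> r + s"
    by (rule ex_merge[OF assms(1) V.growing_chain_code[OF u_bot assms(8) V(2)]
          W.growing_chain_code[OF u_bot assms(9) W(2)]], rule that)
  define e where "e = (\<lambda>q. pair (V.code (K q)) (W.code (L q)))"
  have step':
    "K q < r" "L q < s" "K (Suc q) = K q \<or> K (Suc q) = Suc (K q)" "L (Suc q) = L q \<or> L (Suc q) = Suc (L q)"
    "dominated u (e (Suc q)) (V.code (Suc (K q)))" "dominated u (e (Suc q)) (W.code (Suc (L q)))"
    "\<not> dominated u (e (Suc q)) (e q)" if "q < t" for q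
    using step[OF that] by (auto simp: merge_step_def e_def)
  have KL_le: "K q \<le> r" "L q \<le> s" if "q \<le> t" for q
    using step'(1,2)[of q] KL(3,4) that by (cases "q = t"; simp)+
  have KL_mono: "K p \<le> K q" "L p \<le> L q" if "p \<le> q" "q \<le> t" for p q
    using that
  proof (induction q rule: dec_induct)
    case (step q)
    { case 1 with step step'(3)[of q] show ?case by auto }
    { case 2 with step step'(4)[of q] show ?case by auto }
  qed auto
  have "\<forall>q. \<exists>h. q < t \<longrightarrow> eventually (\<lambda>x. e (Suc q) x \<le> h (V.code (Suc (K q)) x)) u"
    using step'(5) unfolding dominated_def by blast
  from choice[OF this] obtain F
    where F: "\<And>q. q < t \<Longrightarrow> eventually (\<lambda>x. e (Suc q) x \<le> F q (V.code (Suc (K q)) x)) u" by blast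
  have "\<forall>q. \<exists>h. q < t \<longrightarrow> eventually (\<lambda>x. e (Suc q) x \<le> h (W.code (Suc (L q)) x)) u"
    using step'(6) unfolding dominated_def by blast
  from choice[OF this] obtain H
    where H: "\<And>q. q < t \<Longrightarrow> eventually (\<lambda>x. e (Suc q) x \<le> H q (W.code (Suc (L q)) x)) u" by blast
  \<comment> \<open>The finitely many dominations of the merge, made to hold at every leaf. The set
    lies in \<open>u\<close> because there are only \<open>t\<close> levels; passing to a subset
    later preserves these inequalities.\<close>
  define A0 where "A0 = {x \<in> B \<inter> C. \<forall>q\<in>{..<t}. e (Suc q) x \<le> F q (V.code (Suc (K q)) x) \<and>
    e (Suc q) x \<le> H q (W.code (Suc (L q)) x)}"
  have BC: "eventually (\<lambda>x. x \<in> B) u" "eventually (\<lambda>x. x \<in> C) u"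
    using V(2) W(2) assms(8,9) by (auto intro: filter_leD)
  have A0: "eventually (\<lambda>x. x \<in> A0) u"
    unfolding A0_def mem_Collect_eq Int_iff
    by (intro eventually_conj BC eventually_ball_finite ballI F H) auto
  have cong: "e p x = e p y"
    if "x \<in> A0" "y \<in> A0" "p \<le> q" "q \<le> t" "e q x = e q y" for x y p q
    using that KL_mono[OF that(3,4)] KL_le[OF that(4)]
      V.code_cong[of x y "K p" "K q"] W.code_cong[of x y "L p" "L q"]
    by (auto simp: e_def pair_eq_iff A0_def)
  have unbounded: "eventually (\<lambda>x. f (e q x) < e (Suc q) x) u" if "q < t" for q f
    using not_dominatedD[OF assms(1) step'(7)[OF that]] .
  have "\<exists>A\<subseteq>A0. eventually (\<lambda>x. x \<in> A) u \<and>
      (\<forall>x\<in>A. \<forall>q<t. infinite (e (Suc q) ` {y \<in> A. e q y = e q x}))"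
    using A0 cong unbounded by (rule ex_infinitely_branching_subset)
  then obtain A where A: "A \<subseteq> A0" "eventually (\<lambda>x. x \<in> A) u"
    and A_infinite: "\<forall>x\<in>A. \<forall>q<t. infinite (e (Suc q) ` {y \<in> A. e q y = e q x})"
    by (elim exE conjE)
  have AB: "A \<subseteq> B" "A \<subseteq> C" using A(1) by (auto simp: A0_def)
  interpret T: refining_chain A t e
  proof
    show "A \<noteq> {}" using A(2) u_bot by auto
    show "e 0 x = e 0 y" if "x \<in> A" "y \<in> A" for x y
      using that AB V.code_0[of x y] W.code_0[of x y] KL by (auto simp: e_def pair_eq_iff)
    show "e q x = e q y" if "x \<in> A" "y \<in> A" "q < t" "e (Suc q) x = e (Suc q) y" for x y q
      using cong[of x y q "Suc q"] that A(1) by auto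
    show "inj_on (e t) A"
    proof (rule inj_onI)
      fix x y assume xy: "x \<in> A" "y \<in> A" "e t x = e t y"
      then have "V.code r x = V.code r y" using KL by (simp add: e_def pair_eq_iff)
      moreover have "x \<in> B" "y \<in> B" using xy(1,2) AB(1) by auto
      ultimately show "x = y" using V.code_top[of x] V.code_top[of y] by simp
    qed
  qed (use A_infinite in simp)
  interpret TV: dominating_tree V B r anc A t e K F
  proof
    show "e (Suc q) x \<le> F q (V.code (Suc (K q)) x)" if "x \<in> A" "q < t" for x q
      using that A(1) by (auto simp: A0_def)
  qed (use AB KL step' in \<open>auto simp: e_def pair_eq_iff\<close>)
  interpret TW: dominating_tree W C s anc' A t e L H
  proof
    show "e (Suc q) x \<le> H q (W.code (Suc (L q)) x)" if "x \<in> A" "q < t" for x q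
      using that A(1) by (auto simp: A0_def)
  qed (use AB KL step' in \<open>auto simp: e_def pair_eq_iff\<close>)
  have "mono ord_of_nat" by (rule strict_mono_mono[OF strict_mono_ord_of_nat])
  then have "max (cascade_rank V) (cascade_rank W) \<le> cascade_rank T.tree"
    using t(1) by (auto simp: rs T.cascade_rank_tree monoD)
  moreover have "cascade_rank T.tree \<le> cascade_rank V + cascade_rank W"
    using order_trans[OF monoD[OF \<open>mono ord_of_nat\<close> t(2)] ord_of_nat_add_le]
    by (simp add: rs T.cascade_rank_tree)
  moreover have "u \<le> contour T.tree"
    using A(2) by (rule T.le_contour_tree) (rule unbounded)
  ultimately show ?thesis
    using T.tree.mono_seq T.tree.max_Inl TV.increases_order_tree TW.increases_order_tree
      TV.contour_tree_le TW.contour_tree_le by blast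
qed

end
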